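(* Let $(F,X,\mathbb{R}^n)$ be a coherent system with $X$ open in $\mathbb{R}^n$, and let $\Phi$ be its local semiflow. Assume there exists a global attractor $A$ for $\Phi$. Then there exists an equilibrium of $\Phi$, and if the equilibrium is unique, it is globally asymptotically stable.
   Context: System: $(F,X,\mathbb{R}^n)$ ($n\ge1$) is a system if $X\subset\mathbb{R}^n$ is nonempty and convex, the interior of $X$ in $\mathbb{R}^n$ is dense in $X$ (automatic when $X$ is open), and $F\colon X\to\mathbb{R}^n$ extends to a $C^1$ vector field on an open set containing $X$. The maximally defined solutions in $X$, $t\mapsto\Phi_t(a)$, $t\ge0$, of $dx/dt=F(x)$, $x(0)=a\in X$, generate the local semiflow $\Phi=\{\Phi_t\}_{t\ge0}$, $\Phi_t\colon D_t\to X$, where $D_t$ is the set of $a\in X$ for which the solution is defined at time $t$. Dynamics: The orbit of $x$ is $\gamma(x)=\{\Phi_t x: t\ge 0,\ x\in D_t\}$ and its omega limit set is $\omega(x)=\bigcap_{t\ge0}\overline{\gamma(\Phi_t x)}$. A point $p$ is an equilibrium if $\Phi_t p=p$ for all $t\ge0$. $A\subset X$ is positively invariant if $\Phi_t(a)$ is defined and in $A$ for all $a\in A$, $t\ge0$; invariant if in addition $A\neq\varnothing$ and $\Phi_t(A)=A$ for all $t\ge0$. $A$ attracts $x$ if $\overline{\gamma(x)}$ is compact and $\omega(x)\subset A$; the basin of $A$ is the set of points attracted by $A$. $A$ is attracting if it is invariant, connected and compact and its basin is a neighborhood of $A$. $A$ is an attractor if it is attracting and has arbitrarily small positively invariant neighborhoods.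 An attractor is global if it attracts all points of $X$. An equilibrium $q$ is globally asymptotically stable if $\{q\}$ is the global attractor. Interaction graph: $\Gamma(F)$ has vertex set $\{1,\dots,n\}$ and a directed edge $(j,i)$, $j\ne i$, whenever $\partial F_i/\partial x_j$ is not identically $0$ on $X$. The edge $(j,i)$ has label $+1$ if $\partial F_i/\partial x_j\ge0$ on $X$, $-1$ if $\partial F_i/\partial x_j\le 0$ on $X$, and $\theta$ otherwise. A loop is a sequence of $\mu\ge2$ edges $(i_0,i_1),(i_1,i_2),\dots,(i_{\mu-1},i_\mu)$ with $i_\mu=i_0$; it is positive if all its edges are labeled $\pm1$ and the product of these labels is $+1$. $F$ is coherent if every loop of $\Gamma(F)$ is positive. *)

theory Defs
  imports "HOL-Analysis.Analysis"
begin

section \<open>Systems\<close>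

definition C1_on :: "('a::euclidean_space \<Rightarrow> 'b::euclidean_space) \<Rightarrow> 'a set \<Rightarrow> bool" where
  "C1_on G U \<longleftrightarrow>
    (\<exists>G' :: 'a \<Rightarrow> 'a \<Rightarrow>\<^sub>L 'b. (\<forall>x\<in>U. (G has_derivative blinfun_apply (G' x)) (at x)) \<and> continuous_on U G')"

text \<open>The vector field is a total function, but only its values on \<open>X\<close> matter here and below.\<close>

definition dyn_system :: "(real^'n \<Rightarrow> real^'n) \<Rightarrow> (real^'n) set \<Rightarrow> bool" where
  "dyn_system F X \<longleftrightarrow>
    X \<noteq> {} \<and> convex X \<and> X \<subseteq> closure (interior X) \<and>
    (\<exists>U G. open U \<and> X \<subseteq> U \<and> C1_on G U \<and> (\<forall>x\<in>X. G x = F x))"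

section \<open>The local semiflow\<close>

definition solution :: "(real^'n \<Rightarrow> real^'n) \<Rightarrow> (real^'n) set \<Rightarrow> real^'n \<Rightarrow> real set \<Rightarrow> (real \<Rightarrow> real^'n) \<Rightarrow> bool" where
  "solution F X a J u \<longleftrightarrow>
    is_interval J \<and> 0 \<in> J \<and> J \<subseteq> {0..} \<and> u 0 = a \<and>
    (\<forall>t\<in>J. u t \<in> X \<and> (u has_vector_derivative F (u t)) (at t within J))"

definition maximal_solution :: "(real^'n \<Rightarrow> real^'n) \<Rightarrow> (real^'n) set \<Rightarrow> real^'n \<Rightarrow> real set \<Rightarrow> (real \<Rightarrow> real^'n) \<Rightarrow> bool" where
  "maximal_solution F X a J u \<longleftrightarrow>
    solution F X a J u \<and>
    (\<forall>J' v. solution F X a J' v \<and> J \<subseteq> J' \<and> (\<forall>t\<in>J. v t = u t) \<longrightarrow> J' = J)"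

definition flow_dom :: "(real^'n \<Rightarrow> real^'n) \<Rightarrow> (real^'n) set \<Rightarrow> real \<Rightarrow> (real^'n) set" where
  "flow_dom F X t = {a \<in> X. \<exists>J u. maximal_solution F X a J u \<and> t \<in> J}"

text \<open>In a system solutions are unique, so the description determines the value of the
  semiflow at every point of \<open>flow_dom F X t\<close>; elsewhere the value carries no meaning.\<close>

definition flow :: "(real^'n \<Rightarrow> real^'n) \<Rightarrow> (real^'n) set \<Rightarrow> real \<Rightarrow> real^'n \<Rightarrow> real^'n" where
  "flow F X t a = (THE y. \<exists>J u. maximal_solution F X a J u \<and> t \<in> J \<and> u t = y)"

section \<open>Dynamics\<close>

definition orbit :: "(real^'n \<Rightarrow> real^'n) \<Rightarrow> (real^'n) set \<Rightarrow> real^'n \<Rightarrow> (real^'n) set" where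
  "orbit F X x = {flow F X t x | t. t \<ge> 0 \<and> x \<in> flow_dom F X t}"

text \<open>The intersection ranges over the times at which the solution through \<open>x\<close> is defined.
  Closures are taken in the ambient space.  For \<open>A \<subseteq> X\<close>, using closures relative to \<open>X\<close>
  instead would give the same notion of attraction: a bounded orbit whose closure
  is not contained in \<open>X\<close> has omega limit points outside \<open>X\<close>.\<close>

definition omega_limit :: "(real^'n \<Rightarrow> real^'n) \<Rightarrow> (real^'n) set \<Rightarrow> real^'n \<Rightarrow> (real^'n) set" where
  "omega_limit F X x = (\<Inter>t\<in>{t. t \<ge> 0 \<and> x \<in> flow_dom F X t}. closure (orbit F X (flow F X t x)))"

definition equilibrium :: "(real^'n \<Rightarrow> real^'n) \<Rightarrow> (real^'n) set \<Rightarrow> real^'n \<Rightarrow> bool" where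
  "equilibrium F X p \<longleftrightarrow> p \<in> X \<and> (\<forall>t\<ge>0. p \<in> flow_dom F X t \<and> flow F X t p = p)"

definition positively_invariant :: "(real^'n \<Rightarrow> real^'n) \<Rightarrow> (real^'n) set \<Rightarrow> (real^'n) set \<Rightarrow> bool" where
  "positively_invariant F X A \<longleftrightarrow>
    A \<subseteq> X \<and> (\<forall>a\<in>A. \<forall>t\<ge>0. a \<in> flow_dom F X t \<and> flow F X t a \<in> A)"

definition invariant_set :: "(real^'n \<Rightarrow> real^'n) \<Rightarrow> (real^'n) set \<Rightarrow> (real^'n) set \<Rightarrow> bool" where
  "invariant_set F X A \<longleftrightarrow>
    positively_invariant F X A \<and> A \<noteq> {} \<and> (\<forall>t\<ge>0. flow F X t ` A = A)"

definition attracts :: "(real^'n \<Rightarrow> real^'n) \<Rightarrow> (real^'n) set \<Rightarrow> (real^'n) set \<Rightarrow> real^'n \<Rightarrow> bool" where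
  "attracts F X A x \<longleftrightarrow> compact (closure (orbit F X x)) \<and> omega_limit F X x \<subseteq> A"

definition basin :: "(real^'n \<Rightarrow> real^'n) \<Rightarrow> (real^'n) set \<Rightarrow> (real^'n) set \<Rightarrow> (real^'n) set" where
  "basin F X A = {x \<in> X. attracts F X A x}"

text \<open>Neighborhoods are neighborhoods in the state space \<open>X\<close>.\<close>

definition neighborhood_in :: "'a::topological_space set \<Rightarrow> 'a set \<Rightarrow> 'a set \<Rightarrow> bool" where
  "neighborhood_in X A N \<longleftrightarrow> N \<subseteq> X \<and> (\<exists>V. openin (top_of_set X) V \<and> A \<subseteq> V \<and> V \<subseteq> N)"

definition attracting :: "(real^'n \<Rightarrow> real^'n) \<Rightarrow> (real^'n) set \<Rightarrow> (real^'n) set \<Rightarrow> bool" where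
  "attracting F X A \<longleftrightarrow>
    invariant_set F X A \<and> connected A \<and> compact A \<and> neighborhood_in X A (basin F X A)"

definition attractor :: "(real^'n \<Rightarrow> real^'n) \<Rightarrow> (real^'n) set \<Rightarrow> (real^'n) set \<Rightarrow> bool" where
  "attractor F X A \<longleftrightarrow>
    attracting F X A \<and>
    (\<forall>U. neighborhood_in X A U \<longrightarrow>
      (\<exists>N. neighborhood_in X A N \<and> N \<subseteq> U \<and> positively_invariant F X N))"

definition global_attractor :: "(real^'n \<Rightarrow> real^'n) \<Rightarrow> (real^'n) set \<Rightarrow> (real^'n) set \<Rightarrow> bool" where
  "global_attractor F X A \<longleftrightarrow> attractor F X A \<and> (\<forall>x\<in>X. attracts F X A x)"

definition globally_asymptotically_stable :: "(real^'n \<Rightarrow> real^'n) \<Rightarrow> (real^'n) set \<Rightarrow> real^'n \<Rightarrow> bool" where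
  "globally_asymptotically_stable F X q \<longleftrightarrow> equilibrium F X q \<and> global_attractor F X {q}"

section \<open>The interaction graph\<close>

text \<open>\<open>partial_deriv F X i j x\<close> is the partial derivative of the \<open>i\<close>-th component in the \<open>j\<close>-th
  variable.  In a system the derivative within \<open>X\<close> is unique, since \<open>X\<close> is convex with nonempty
  interior; it agrees with that of every \<open>C\<^sup>1\<close> extension and, when \<open>X\<close> is open, with the usual
  derivative.\<close>

definition partial_deriv :: "(real^'n \<Rightarrow> real^'n) \<Rightarrow> (real^'n) set \<Rightarrow> 'n \<Rightarrow> 'n \<Rightarrow> real^'n \<Rightarrow> real" where
  "partial_deriv F X i j x = frechet_derivative F (at x within X) (axis j 1) $ i"

definition interaction_edges :: "(real^'n \<Rightarrow> real^'n) \<Rightarrow> (real^'n) set \<Rightarrow> ('n \<times> 'n) set" where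
  "interaction_edges F X = {(j, i). j \<noteq> i \<and> \<not> (\<forall>x\<in>X. partial_deriv F X i j x = 0)}"

text \<open>\<open>None\<close> stands for the label \<open>\<theta>\<close>.\<close>

definition edge_label :: "(real^'n \<Rightarrow> real^'n) \<Rightarrow> (real^'n) set \<Rightarrow> 'n \<times> 'n \<Rightarrow> int option" where
  "edge_label F X = (\<lambda>(j, i).
    if \<forall>x\<in>X. partial_deriv F X i j x \<ge> 0 then Some 1
    else if \<forall>x\<in>X. partial_deriv F X i j x \<le> 0 then Some (- 1)
    else None)"

definition graph_loop :: "(real^'n \<Rightarrow> real^'n) \<Rightarrow> (real^'n) set \<Rightarrow> ('n \<times> 'n) list \<Rightarrow> bool" where
  "graph_loop F X es \<longleftrightarrow>
    length es \<ge> 2 \<and> set es \<subseteq> interaction_edges F X \<and>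
    (\<forall>k. Suc k < length es \<longrightarrow> snd (es ! k) = fst (es ! Suc k)) \<and>
    snd (last es) = fst (hd es)"

definition positive_loop :: "(real^'n \<Rightarrow> real^'n) \<Rightarrow> (real^'n) set \<Rightarrow> ('n \<times> 'n) list \<Rightarrow> bool" where
  "positive_loop F X es \<longleftrightarrow>
    graph_loop F X es \<and> (\<forall>e\<in>set es. edge_label F X e \<noteq> None) \<and>
    prod_list (map (\<lambda>e. the (edge_label F X e)) es) = 1"

definition coherent :: "(real^'n \<Rightarrow> real^'n) \<Rightarrow> (real^'n) set \<Rightarrow> bool" where
  "coherent F X \<longleftrightarrow> (\<forall>es. graph_loop F X es \<longrightarrow> positive_loop F X es)"

end

theory Submission
  imports Defs
begin

text \<open>
  Existence of an equilibrium is a fixed point argument that does not see the interaction graph.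
  Let \<open>K\<close> be a compact convex neighborhood of \<open>A\<close> in \<open>X\<close> and \<open>N \<subseteq> K\<close> a positively invariant
  neighborhood of \<open>A\<close>.  All points of \<open>K\<close> are in \<open>N\<close> from some common time \<open>T\<close> on.  Given \<open>s > 0\<close>,
  let each point \<open>x\<close> flow for the time \<open>s + \<tau> x\<close>, where \<open>\<tau>\<close> is continuous, vanishes on \<open>A\<close>, and is
  equal to \<open>T\<close> except on a neighborhood of \<open>A\<close> inside \<open>N\<close>.  This maps \<open>K\<close> into \<open>N \<subseteq> K\<close>, so by Brouwer
  there is a fixed point \<open>p\<close>.  It is periodic, hence in \<open>A\<close>, hence \<open>\<tau> p = 0\<close>, and \<open>p\<close> is a fixed point
  of the time-\<open>s\<close> map itself (\<open>fixed_point_of_time_map\<close>).  Letting \<open>s\<close> tend to \<open>0\<close> gives an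
  equilibrium.  The same argument works inside every closed convex positively invariant set
  (\<open>exists_equilibrium_in_invariant_convex\<close>), and the second part depends on that.

  For stability it is enough to show \<open>A = {q}\<close>.  By coherence the system is a cascade of
  systems that are monotone for the order of some orthant: all edges inside a strongly connected
  component of the graph lie on loops, and since loops are positive, the signs of walks from a base
  vertex define signs \<open>\<sigma>\<close> that make the component cooperative (\<open>exists_cooperative_block\<close>).  Going
  down the cascade, suppose that all points of \<open>A\<close> agree on the coordinates \<open>S\<close> treated so far, and
  let \<open>C\<close> be the next component.  The heart of the proof is that a point \<open>a\<close> of \<open>A\<close> which is maximal
  in the order on the \<open>C\<close>-coordinates is stationary in these coordinates
  (\<open>maximal_point_stationary\<close>).  Indeed, let \<open>c\<close> be a limit point of the backward orbit of \<open>a\<close>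
  in \<open>A\<close>, and choose \<open>x\<close> slightly above \<open>c\<close>.  By monotonicity the orbit of \<open>x\<close> stays above the orbits
  of those points of the backward orbit that are close to \<open>c\<close>.  Since its limit points are in \<open>A\<close>, and
  the points of the backward orbit are maximal, the orbit of \<open>x\<close> must, in the \<open>C\<close>-coordinates,
  accumulate at points of the backward orbit, in particular at points that are strictly below \<open>x\<close>.
  But if the orbit of \<open>x\<close> comes back strictly below \<open>x\<close>, then it is below \<open>x\<close> at all late times, and by
  monotonicity all its limit points coincide in the \<open>C\<close>-coordinates (\<open>eventually_below_start\<close>,
  \<open>limit_stationary_if_below_start\<close>).  As \<open>a\<close> is one of them, it does not move.

  Hence the points of \<open>X\<close> with the same \<open>S \<union> C\<close>-coordinates as \<open>a\<close> form a positively invariant convex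
  set.  It contains an equilibrium, which can only be \<open>q\<close>.  So every maximal point, and with the
  reversed order every minimal point, agrees with \<open>q\<close> on \<open>S \<union> C\<close>, and therefore every point of \<open>A\<close>
  does (\<open>block_collapses\<close>).

  All comparisons of solutions come from one differential inequality, \<open>p' \<le> M p\<close>.  Solutions for all
  times are obtained from the attractor: a maximal solution has a limit point in \<open>A\<close>, so it enters a
  positively invariant neighborhood of \<open>A\<close>, and there solutions are defined forever.
\<close>

section \<open>Differential inequalities\<close>

text \<open>Gronwall's inequality in differential form: \<open>p t * exp (- M t)\<close> is nonincreasing.\<close>

lemma exp_growth:
  fixes p p' :: "real \<Rightarrow> real"
  assumes der: "\<And>t. t \<in> {0..T} \<Longrightarrow> (p has_real_derivative p' t) (at t within {0..T})"
    and le: "\<And>t. t \<in> {0..T} \<Longrightarrow> p' t \<le> M * p t"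
    and t: "t \<in> {0..T}"
  shows "p t \<le> exp (M * t) * p 0"
proof -
  define h where "h s = p s * exp (- (M * s))" for s
  have dh: "(h has_real_derivative (p' s - M * p s) * exp (- (M * s))) (at s within {0..T})"
    if "s \<in> {0..T}" for s
    unfolding h_def by (auto intro!: derivative_eq_intros der[OF that] simp: algebra_simps)
  have "h t \<le> h 0"
  proof (rule DERIV_nonpos_imp_decreasing_open[of 0 t h])
    show "0 \<le> t" using t by simp
    show "\<exists>y. DERIV h s :> y \<and> y \<le> 0" if "0 < s" "s < t" for s
    proof -
      have "(h has_real_derivative (p' s - M * p s) * exp (- (M * s))) (at s within {0<..<T})"
        by (rule DERIV_subset[OF dh]) (use that t in auto)
      then have "DERIV h s :> (p' s - M * p s) * exp (- (M * s))"
        using that t by (subst (asm) at_within_open) auto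
      moreover have "(p' s - M * p s) * exp (- (M * s)) \<le> 0"
        using le[of s] that t by (simp add: mult_nonpos_nonneg)
      ultimately show ?thesis by blast
    qed
    have "continuous_on {0..T} h" using dh by (rule DERIV_continuous_on)
    then show "continuous_on {0..t} h" by (rule continuous_on_subset) (use t in auto)
  qed
  then have "p t * exp (- (M * t)) \<le> p 0" by (simp add: h_def)
  then have "p t * exp (- (M * t)) * exp (M * t) \<le> p 0 * exp (M * t)"
    by (rule mult_right_mono) simp
  then show ?thesis by (simp add: mult.assoc exp_minus field_simps)
qed

text \<open>The quadratic form of a matrix with entries bounded by \<open>M\<close>; both energies below have derivatives of
  this form.\<close>

lemma sum_cross_le:
  fixes d :: "'i \<Rightarrow> real"
  assumes "finite P" "0 \<le> M" "\<And>i j. i \<in> P \<Longrightarrow> j \<in> P \<Longrightarrow> \<bar>b i j\<bar> \<le> M"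
  shows "\<bar>\<Sum>i\<in>P. \<Sum>j\<in>P. b i j * (d i * d j)\<bar> \<le> M * real (card P) * (\<Sum>i\<in>P. (d i)\<^sup>2)"
proof -
  have *: "\<bar>b i j * (d i * d j)\<bar> \<le> M / 2 * (d i)\<^sup>2 + M / 2 * (d j)\<^sup>2" if "i \<in> P" "j \<in> P" for i j
  proof -
    have "0 \<le> (\<bar>d i\<bar> - \<bar>d j\<bar>)\<^sup>2" by simp
    then have "2 * \<bar>d i * d j\<bar> \<le> (d i)\<^sup>2 + (d j)\<^sup>2"
      by (simp add: power2_diff abs_mult mult.assoc)
    moreover have "\<bar>b i j * (d i * d j)\<bar> \<le> M * \<bar>d i * d j\<bar>"
      unfolding abs_mult[of "b i j"] using assms(3)[OF that] by (rule mult_right_mono) simp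
    ultimately show ?thesis
      using mult_left_mono[of "\<bar>d i * d j\<bar>" "((d i)\<^sup>2 + (d j)\<^sup>2) / 2" M] assms(2)
      by (simp add: field_simps)
  qed
  have "\<bar>\<Sum>i\<in>P. \<Sum>j\<in>P. b i j * (d i * d j)\<bar> \<le> (\<Sum>i\<in>P. \<Sum>j\<in>P. \<bar>b i j * (d i * d j)\<bar>)"
    by (intro order.trans[OF sum_abs] sum_mono sum_abs)
  also have "\<dots> \<le> (\<Sum>i\<in>P. \<Sum>j\<in>P. M / 2 * (d i)\<^sup>2 + M / 2 * (d j)\<^sup>2)"
    using * by (intro sum_mono) auto
  also have "\<dots> = M * real (card P) * (\<Sum>i\<in>P. (d i)\<^sup>2)"
    by (simp only: sum.distrib sum_constant sum_distrib_left[symmetric]) (simp add: field_simps)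
  finally show ?thesis .
qed

text \<open>The square of the negative part is differentiable also at \<open>0\<close>, so it can measure how far an
  inequality between coordinates is violated.\<close>

lemma has_real_derivative_neg_part_sq:
  "((\<lambda>z::real. (min z 0)\<^sup>2) has_real_derivative 2 * min z 0) (at z)"
proof -
  consider "z < 0" | "z > 0" | "z = 0" by linarith
  then show ?thesis
  proof cases
    case 1
    have "((\<lambda>z::real. z\<^sup>2) has_real_derivative 2 * z) (at z)"
      by (auto intro!: derivative_eq_intros)
    then have "((\<lambda>z::real. (min z 0)\<^sup>2) has_real_derivative 2 * z) (at z)"
      by (rule DERIV_cong_ev[THEN iffD1, rotated -1])
        (use 1 eventually_nhds_in_open[of "{..<0::real}" z] in \<open>auto elim!: eventually_mono\<close>)
    then show ?thesis using 1 by simp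
  next
    case 2
    have "((\<lambda>z::real. 0) has_real_derivative 0) (at z)" by simp
    then have "((\<lambda>z::real. (min z 0)\<^sup>2) has_real_derivative 0) (at z)"
      by (rule DERIV_cong_ev[THEN iffD1, rotated -1])
        (use 2 eventually_nhds_in_open[of "{0::real<..}" z] in \<open>auto elim!: eventually_mono\<close>)
    then show ?thesis using 2 by simp
  next
    case 3
    have "((\<lambda>h::real. (min h 0)\<^sup>2 / h) \<longlongrightarrow> 0) (at 0)"
    proof (rule Lim_null_comparison)
      show "\<forall>\<^sub>F h in at 0. norm ((min h 0)\<^sup>2 / h) \<le> \<bar>h::real\<bar>"
        by (rule always_eventually)
          (auto simp: min_def power2_eq_square abs_mult divide_simps)
      show "((\<lambda>h::real. \<bar>h\<bar>) \<longlongrightarrow> 0) (at 0)"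
        using tendsto_rabs[OF tendsto_ident_at[of "0::real" UNIV]] by simp
    qed
    then show ?thesis using 3 by (simp add: DERIV_def)
  qed
qed

section \<open>Comparing two solution curves\<close>

text \<open>The cascade is followed in the full space \<open>X\<close> rather than in projections of it; statements about a
  projection become statements about selected coordinates.\<close>

definition agree :: "'n set \<Rightarrow> real^'n \<Rightarrow> real^'n \<Rightarrow> bool" where
  "agree P x y \<longleftrightarrow> (\<forall>i\<in>P. x $ i = y $ i)"

lemma agree_refl: "agree P x x"
  and agree_sym: "agree P x y \<Longrightarrow> agree P y x"
  and agree_trans: "agree P x y \<Longrightarrow> agree P y z \<Longrightarrow> agree P x z"
  and agree_Un: "agree (P \<union> Q) x y \<longleftrightarrow> agree P x y \<and> agree Q x y"
  by (auto simp: agree_def)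

text \<open>\<open>D i j\<close> is the partial derivative of the \<open>i\<close>-th component in the \<open>j\<close>-th variable.\<close>

locale C1_field =
  fixes F :: "real^'n \<Rightarrow> real^'n" and X :: "(real^'n) set" and D :: "'n \<Rightarrow> 'n \<Rightarrow> real^'n \<Rightarrow> real"
  assumes open_X: "open X" and convex_X: "convex X"
    and field_deriv: "x \<in> X \<Longrightarrow> (F has_derivative (\<lambda>h. \<chi> i. \<Sum>j\<in>UNIV. D i j x * h $ j)) (at x)"
    and continuous_D: "continuous_on X (D i j)"
begin

definition curve :: "real \<Rightarrow> (real \<Rightarrow> real^'n) \<Rightarrow> bool" where
  "curve T u \<longleftrightarrow>
    (\<forall>t\<in>{0..T}. u t \<in> X \<and> (u has_vector_derivative F (u t)) (at t within {0..T}))"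

text \<open>No edge of the interaction graph enters \<open>P\<close> from outside, so the coordinates in \<open>P\<close> evolve
  autonomously.\<close>

definition upstream_closed :: "'n set \<Rightarrow> bool" where
  "upstream_closed P \<longleftrightarrow> (\<forall>i\<in>P. \<forall>j. j \<notin> P \<longrightarrow> (\<forall>x\<in>X. D i j x = 0))"

text \<open>The intermediate point depends on the component.  This is harmless, because the estimates below
  use each component of the field separately and need only signs and bounds of the derivatives.\<close>

lemma mean_value:
  assumes "convex K" "K \<subseteq> X" "x \<in> K" "y \<in> K"
  shows "\<exists>\<xi>\<in>K. F y $ i - F x $ i = (\<Sum>j\<in>UNIV. D i j \<xi> * (y $ j - x $ j))"
proof -
  let ?g = "\<lambda>s::real. x + s *\<^sub>R (y - x)"
  have inK: "?g s \<in> K" if "s \<in> {0..1}" for s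
  proof -
    have "?g s = (1 - s) *\<^sub>R x + s *\<^sub>R y" by (simp add: algebra_simps)
    with assms that show ?thesis by (auto intro!: convexD)
  qed
  have "((\<lambda>s. F (?g s) $ i) has_derivative (\<lambda>r. \<Sum>j\<in>UNIV. D i j (?g s) * (r *\<^sub>R (y - x)) $ j))
      (at s within {0..1})" if "0 \<le> s" "s \<le> 1" for s
  proof -
    have "(?g has_derivative (\<lambda>r. r *\<^sub>R (y - x))) (at s within {0..1})"
      by (auto intro!: derivative_eq_intros)
    moreover have "(F has_derivative (\<lambda>h. \<chi> i. \<Sum>j\<in>UNIV. D i j (?g s) * h $ j)) (at (?g s))"
      using that inK assms(2) by (intro field_deriv) auto
    ultimately have "((F \<circ> ?g) has_derivative ((\<lambda>h. \<chi> i. \<Sum>j\<in>UNIV. D i j (?g s) * h $ j) \<circ> (\<lambda>r. r *\<^sub>R (y - x))))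
      (at s within {0..1})"
      by (intro diff_chain_within) (auto intro: has_derivative_at_withinI)
    then have "((\<lambda>s. (F \<circ> ?g) s $ i) has_derivative (\<lambda>r. ((\<lambda>h. \<chi> i. \<Sum>j\<in>UNIV. D i j (?g s) * h $ j) \<circ> (\<lambda>r. r *\<^sub>R (y - x))) r $ i))
      (at s within {0..1})"
      by (rule bounded_linear.has_derivative[OF bounded_linear_vec_nth])
    then show ?thesis by (simp add: o_def)
  qed
  then obtain s where s: "s \<in> {0..1}"
    "F (?g 1) $ i - F (?g 0) $ i = (\<Sum>j\<in>UNIV. D i j (?g s) * ((1 - 0) *\<^sub>R (y - x)) $ j)"
    using mvt_very_simple[of 0 1 "\<lambda>s. F (?g s) $ i" "\<lambda>s r. \<Sum>j\<in>UNIV. D i j (?g s) * (r *\<^sub>R (y - x)) $ j"]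
    by auto
  then show ?thesis using inK[of s] by (intro bexI[of _ "?g s"]) auto
qed

lemma bound_D:
  assumes "compact K" "K \<subseteq> X"
  obtains M where "0 \<le> M" "\<And>i j x. x \<in> K \<Longrightarrow> \<bar>D i j x\<bar> \<le> M"
proof -
  have "bounded (D i j ` K)" for i j
    using assms continuous_D by (intro compact_imp_bounded compact_continuous_image)
      (auto intro: continuous_on_subset)
  then have "bounded (\<Union>i. \<Union>j. D i j ` K)" by (intro bounded_UN) auto
  then obtain M where "\<forall>x\<in>(\<Union>i. \<Union>j. D i j ` K). norm x \<le> M" by (auto simp: bounded_iff)
  then have "norm (D i j x) \<le> M" if "x \<in> K" for i j x using that by blast
  then have "\<bar>D i j x\<bar> \<le> \<bar>M\<bar>" if "x \<in> K" for i j x using that by (metis abs_ge_self order.trans real_norm_def)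
  then show ?thesis using that[of "\<bar>M\<bar>"] by auto
qed

lemma curve_continuous: "curve T u \<Longrightarrow> continuous_on {0..T} u"
  unfolding curve_def
  by (auto simp: continuous_on_eq_continuous_within intro: has_vector_derivative_continuous)

lemma curve_component:
  assumes "curve T u" "t \<in> {0..T}"
  shows "((\<lambda>t. u t $ i) has_real_derivative F (u t) $ i) (at t within {0..T})"
  using bounded_linear.has_vector_derivative[OF bounded_linear_vec_nth, of u "F (u t)" "at t within {0..T}" i] assms
  by (auto simp: curve_def has_real_derivative_iff_has_vector_derivative)

text \<open>If \<open>P\<close> is upstream closed, then by the mean value theorem the derivative of
  \<open>\<Sum>i\<in>P. (v\<^sub>i - u\<^sub>i)\<^sup>2\<close> along two curves is a quadratic form in the same differences.  The two bounds are
  the forward and the backward estimate.\<close>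

lemma coordinate_growth:
  assumes P: "upstream_closed P"
    and K: "convex K" "K \<subseteq> X" and M: "0 \<le> M" "\<And>i j x. x \<in> K \<Longrightarrow> \<bar>D i j x\<bar> \<le> M"
    and u: "curve T u" and v: "curve T v"
    and inK: "\<And>t. t \<in> {0..T} \<Longrightarrow> u t \<in> K \<and> v t \<in> K"
    and t: "t \<in> {0..T}"
  defines "c \<equiv> 2 * M * real (card P)"
    and "r \<equiv> \<lambda>t. \<Sum>i\<in>P. (v t $ i - u t $ i)\<^sup>2"
  shows "r t \<le> exp (c * t) * r 0" "r 0 \<le> exp (c * t) * r t"
proof -
  define r' where "r' t = (\<Sum>i\<in>P. 2 * (v t $ i - u t $ i) * (F (v t) $ i - F (u t) $ i))" for t
  have der: "(r has_real_derivative r' t) (at t within {0..T})" if "t \<in> {0..T}" for t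
    unfolding r_def r'_def
    by (auto intro!: derivative_eq_intros curve_component[OF u that] curve_component[OF v that]
        simp: algebra_simps)
  have bound: "\<bar>r' t\<bar> \<le> c * r t" if t: "t \<in> {0..T}" for t
  proof -
    let ?d = "\<lambda>i. v t $ i - u t $ i"
    have "\<exists>\<xi>\<in>K. F (v t) $ i - F (u t) $ i = (\<Sum>j\<in>UNIV. D i j \<xi> * ?d j)" for i
      using mean_value[OF K] inK[OF t] by blast
    then obtain \<xi> where \<xi>: "\<And>i. \<xi> i \<in> K"
      "\<And>i. F (v t) $ i - F (u t) $ i = (\<Sum>j\<in>UNIV. D i j (\<xi> i) * ?d j)" by metis
    have "(\<Sum>j\<in>UNIV. D i j (\<xi> i) * ?d j) = (\<Sum>j\<in>P. D i j (\<xi> i) * ?d j)" if "i \<in> P" for i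
      using P \<xi>(1)[of i] K(2) that unfolding upstream_closed_def
      by (intro sum.mono_neutral_right) auto
    then have "r' t = (\<Sum>i\<in>P. 2 * ?d i * (\<Sum>j\<in>P. D i j (\<xi> i) * ?d j))"
      unfolding r'_def \<xi>(2) by (intro sum.cong) auto
    also have "\<dots> = 2 * (\<Sum>i\<in>P. \<Sum>j\<in>P. D i j (\<xi> i) * (?d i * ?d j))"
      by (simp add: sum_distrib_left algebra_simps)
    finally have "\<bar>r' t\<bar> = 2 * \<bar>\<Sum>i\<in>P. \<Sum>j\<in>P. D i j (\<xi> i) * (?d i * ?d j)\<bar>"
      by (simp add: abs_mult)
    also have "\<dots> \<le> 2 * (M * real (card P) * (\<Sum>i\<in>P. (?d i)\<^sup>2))"
      using M \<xi>(1) by (intro mult_left_mono sum_cross_le) auto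
    finally show ?thesis by (simp add: c_def r_def algebra_simps)
  qed
  show "r t \<le> exp (c * t) * r 0"
    using der bound t by (intro exp_growth[of T r r' c t]) (auto simp: abs_le_iff)
  have "- r t \<le> exp (- c * t) * - r 0"
  proof (rule exp_growth[of T "\<lambda>t. - r t" "\<lambda>t. - r' t" "- c"])
    show "((\<lambda>t. - r t) has_real_derivative - r' s) (at s within {0..T})" if "s \<in> {0..T}" for s
      using der[OF that] by (auto intro!: derivative_eq_intros)
    show "- r' s \<le> - c * - r s" if "s \<in> {0..T}" for s
      using bound[OF that] by (auto simp: abs_le_iff)
  qed (use t in auto)
  then have "exp (- c * t) * r 0 \<le> r t" by simp
  then have "exp (c * t) * (exp (- c * t) * r 0) \<le> exp (c * t) * r t" by (rule mult_left_mono) simp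
  then show "r 0 \<le> exp (c * t) * r t"
    by (simp add: exp_minus mult.assoc[symmetric])
qed

text \<open>Convexity of \<open>X\<close> is what allows a common compact convex set, on which the mean value theorem and a
  bound on the derivatives are both available.\<close>

lemma curves_in_compact_convex:
  assumes "curve T u" "curve T v"
  obtains K where "compact K" "convex K" "K \<subseteq> X" "\<And>t. t \<in> {0..T} \<Longrightarrow> u t \<in> K \<and> v t \<in> K"
proof
  let ?K = "convex hull (u ` {0..T} \<union> v ` {0..T})"
  show "compact ?K"
    using assms[THEN curve_continuous]
    by (intro compact_convex_hull compact_Un compact_continuous_image) auto
  show "?K \<subseteq> X"
    using assms convex_X by (intro hull_minimal) (auto simp: curve_def)
  show "u t \<in> ?K \<and> v t \<in> ?K" if "t \<in> {0..T}" for t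
    using that by (auto intro: hull_inc)
qed auto

text \<open>For \<open>P = UNIV\<close> this is uniqueness of solutions, forward and backward; for smaller \<open>P\<close> it says that
  the \<open>P\<close>-coordinates behave like a system of their own.\<close>

lemma agree_iff:
  assumes "upstream_closed P" "curve T u" "curve T v" "t \<in> {0..T}"
  shows "agree P (u t) (v t) \<longleftrightarrow> agree P (u 0) (v 0)"
proof -
  obtain K where K: "compact K" "convex K" "K \<subseteq> X" "\<And>t. t \<in> {0..T} \<Longrightarrow> u t \<in> K \<and> v t \<in> K"
    using curves_in_compact_convex assms(2,3) by blast
  obtain M where M: "0 \<le> M" "\<And>i j x. x \<in> K \<Longrightarrow> \<bar>D i j x\<bar> \<le> M"
    using bound_D K by blast
  have *: "(\<Sum>i\<in>P. (v t $ i - u t $ i)\<^sup>2) = 0 \<longleftrightarrow> agree P (u t) (v t)" for t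
    by (subst sum_nonneg_eq_0_iff) (auto simp: agree_def)
  show ?thesis
    using coordinate_growth[OF assms(1) K(2,3) M assms(2,3) K(4) assms(4)]
      sum_nonneg[of P "\<lambda>i. (v t $ i - u t $ i)\<^sup>2"] sum_nonneg[of P "\<lambda>i. (v 0 $ i - u 0 $ i)\<^sup>2"]
    unfolding *[symmetric] by force
qed

lemma upstream_closed_UNIV: "upstream_closed UNIV"
  by (simp add: upstream_closed_def)

lemma curve_unique:
  assumes "curve T u" "curve T v" "u 0 = v 0" "t \<in> {0..T}"
  shows "u t = v t"
  using agree_iff[OF upstream_closed_UNIV assms(1,2,4)] assms(3) by (simp add: agree_def vec_eq_iff)

text \<open>The comparison theorem of Mueller and Kamke for the coordinates \<open>C\<close>, driven by identical inputs \<open>S\<close>.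
  With \<open>d\<^sub>i = \<sigma>\<^sub>i (v\<^sub>i - u\<^sub>i)\<close> the energy \<open>\<Sum>i\<in>C. (min d\<^sub>i 0)\<^sup>2\<close> starts at \<open>0\<close> and satisfies \<open>p' \<le> c p\<close>:
  off-diagonal coefficients are nonnegative, so replacing \<open>d\<^sub>j\<close> by its negative part can only
  increase its product with the nonpositive number \<open>min d\<^sub>i 0\<close>.\<close>

lemma monotone_curves:
  assumes S: "upstream_closed S" and SC: "upstream_closed (S \<union> C)"
    and disj: "S \<inter> C = {}"
    and sign: "\<And>i. \<bar>\<sigma> i\<bar> = (1::real)"
    and coop: "\<And>i j x. i \<in> C \<Longrightarrow> j \<in> C \<Longrightarrow> i \<noteq> j \<Longrightarrow> x \<in> X \<Longrightarrow> 0 \<le> \<sigma> i * \<sigma> j * D i j x"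
    and u: "curve T u" and v: "curve T v"
    and eq0: "\<And>i. i \<in> S \<Longrightarrow> u 0 $ i = v 0 $ i"
    and le0: "\<And>i. i \<in> C \<Longrightarrow> \<sigma> i * u 0 $ i \<le> \<sigma> i * v 0 $ i"
    and t: "t \<in> {0..T}" and i: "i \<in> C"
  shows "\<sigma> i * u t $ i \<le> \<sigma> i * v t $ i"
proof -
  obtain K where K: "compact K" "convex K" "K \<subseteq> X" "\<And>t. t \<in> {0..T} \<Longrightarrow> u t \<in> K \<and> v t \<in> K"
    using curves_in_compact_convex u v by blast
  obtain M where M: "0 \<le> M" "\<And>i j x. x \<in> K \<Longrightarrow> \<bar>D i j x\<bar> \<le> M"
    using bound_D K by blast
  have eqS: "u t $ i = v t $ i" if "i \<in> S" "t \<in> {0..T}" for i t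
    using agree_iff[OF S u v, of t] that eq0 by (simp add: agree_def)
  have sq: "\<sigma> i * \<sigma> i = 1" for i using sign[of i] by (auto simp: abs_if split: if_splits)
  define d where "d t i = \<sigma> i * (v t $ i - u t $ i)" for t i
  define p where "p t = (\<Sum>i\<in>C. (min (d t i) 0)\<^sup>2)" for t
  define p' where "p' t = (\<Sum>i\<in>C. 2 * min (d t i) 0 * (\<sigma> i * (F (v t) $ i - F (u t) $ i)))" for t
  define c where "c = 2 * M * real (card C)"
  have "p t \<le> exp (c * t) * p 0"
  proof (rule exp_growth[of T p p' c])
    show "(p has_real_derivative p' s) (at s within {0..T})" if "s \<in> {0..T}" for s
      unfolding p_def p'_def
    proof (rule DERIV_sum)
      fix i assume "i \<in> C"
      have "((\<lambda>t. d t i) has_real_derivative \<sigma> i * (F (v s) $ i - F (u s) $ i)) (at s within {0..T})"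
        unfolding d_def
        by (auto intro!: derivative_eq_intros curve_component[OF u that] curve_component[OF v that])
      from DERIV_chain2[OF has_real_derivative_neg_part_sq this]
      show "((\<lambda>t. (min (d t i) 0)\<^sup>2) has_real_derivative
          2 * min (d s i) 0 * (\<sigma> i * (F (v s) $ i - F (u s) $ i))) (at s within {0..T})" .
    qed
    show "p' s \<le> c * p s" if s: "s \<in> {0..T}" for s
    proof -
      let ?n = "\<lambda>i. min (d s i) 0"
      have "\<exists>\<xi>\<in>K. F (v s) $ i - F (u s) $ i = (\<Sum>j\<in>UNIV. D i j \<xi> * (v s $ j - u s $ j))" for i
        using mean_value[OF K(2,3)] K(4)[OF s] by blast
      then obtain \<xi> where \<xi>: "\<And>i. \<xi> i \<in> K"
        "\<And>i. F (v s) $ i - F (u s) $ i = (\<Sum>j\<in>UNIV. D i j (\<xi> i) * (v s $ j - u s $ j))" by metis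
      define b where "b i j = \<sigma> i * \<sigma> j * D i j (\<xi> i)" for i j
      have red: "\<sigma> i * (F (v s) $ i - F (u s) $ i) = (\<Sum>j\<in>C. b i j * d s j)" if "i \<in> C" for i
      proof -
        have "(\<Sum>j\<in>UNIV. D i j (\<xi> i) * (v s $ j - u s $ j)) = (\<Sum>j\<in>C. D i j (\<xi> i) * (v s $ j - u s $ j))"
        proof (rule sum.mono_neutral_right)
          have "D i j (\<xi> i) = 0" if "j \<notin> S \<union> C" for j
            using SC \<xi>(1)[of i] K(3) \<open>i \<in> C\<close> that unfolding upstream_closed_def by blast
          then show "\<forall>j\<in>UNIV - C. D i j (\<xi> i) * (v s $ j - u s $ j) = 0"
            using eqS[OF _ s] by fastforce
        qed auto
        then show ?thesis
          unfolding \<xi>(2) b_def d_def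
          by (simp add: sum_distrib_left mult.assoc mult.left_commute[of "\<sigma> _" "D _ _ _"] )
             (simp add: mult.assoc[symmetric] sq)
      qed
      have "p' s = (\<Sum>i\<in>C. 2 * ?n i * (\<Sum>j\<in>C. b i j * d s j))"
        unfolding p'_def using red by (intro sum.cong) auto
      also have "\<dots> = 2 * (\<Sum>i\<in>C. \<Sum>j\<in>C. b i j * (?n i * d s j))"
        by (simp add: sum_distrib_left algebra_simps)
      also have "\<dots> \<le> 2 * (\<Sum>i\<in>C. \<Sum>j\<in>C. b i j * (?n i * ?n j))"
      proof (rule mult_left_mono[OF sum_mono[OF sum_mono]])
        fix i j assume ij: "i \<in> C" "j \<in> C"
        show "b i j * (?n i * d s j) \<le> b i j * (?n i * ?n j)"
        proof (cases "i = j")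
          case True then show ?thesis by (auto simp: min_def)
        next
          case False
          then have "0 \<le> b i j" using coop[OF ij] \<xi>(1)[of i] K(3) by (auto simp: b_def)
          moreover have "?n i * d s j \<le> ?n i * ?n j" by (rule mult_left_mono_neg) auto
          ultimately show ?thesis by (rule mult_left_mono[rotated])
        qed
      qed simp
      also have "\<dots> \<le> 2 * (M * real (card C) * (\<Sum>i\<in>C. (?n i)\<^sup>2))"
      proof -
        have "\<bar>b i j\<bar> \<le> M" for i j
          using M(2) \<xi>(1) by (simp add: b_def abs_mult sign)
        then have "\<bar>\<Sum>i\<in>C. \<Sum>j\<in>C. b i j * (?n i * ?n j)\<bar> \<le> M * real (card C) * (\<Sum>i\<in>C. (?n i)\<^sup>2)"
          using M(1) by (intro sum_cross_le) auto
        then show ?thesis by (simp add: abs_le_iff)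
      qed
      finally show ?thesis by (simp add: p_def c_def algebra_simps)
    qed
  qed (rule t)
  moreover have "p 0 = 0" proof -
    have "min (d 0 i) 0 = 0" if "i \<in> C" for i
      using le0[OF that] by (simp add: d_def right_diff_distrib)
    then show ?thesis by (simp add: p_def)
  qed
  moreover have "0 \<le> p t" by (simp add: p_def sum_nonneg)
  ultimately have "p t = 0" by simp
  then have "min (d t i) 0 = 0"
    unfolding p_def using i by (subst (asm) sum_nonneg_eq_0_iff) auto
  then have "0 \<le> d t i" by linarith
  then show ?thesis by (simp add: d_def right_diff_distrib)
qed

end

lemma (in C1_field) compact_convex_neighborhood:
  assumes "compact I" "I \<subseteq> X"
  obtains K e where "0 < e" "compact K" "convex K" "K \<subseteq> X" "\<And>a. a \<in> I \<Longrightarrow> cball a e \<subseteq> K"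
proof -
  obtain e where e: "0 < e" "(\<Union>a\<in>I. ball a e) \<subseteq> X"
    using compact_subset_open_imp_ball_epsilon_subset[OF assms(1) open_X assms(2)] by blast
  let ?B = "{a + b |a b. a \<in> I \<and> b \<in> cball 0 (e / 2)}"
  show thesis
  proof
    show "0 < e / 2" using e(1) by simp
    show "compact (convex hull ?B)" using assms(1) by (intro compact_convex_hull compact_sums) auto
    have "?B \<subseteq> X"
    proof
      fix y assume "y \<in> ?B"
      then obtain a b where "y = a + b" "a \<in> I" "norm b \<le> e / 2" by auto
      then have "y \<in> ball a e" using e(1) by (simp add: dist_norm)
      then show "y \<in> X" using e(2) \<open>a \<in> I\<close> by blast
    qed
    then show "convex hull ?B \<subseteq> X" using convex_X by (rule hull_minimal)
    show "cball a (e / 2) \<subseteq> convex hull ?B" if "a \<in> I" for a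
    proof
      fix y assume "y \<in> cball a (e / 2)"
      then have "y = a + (y - a)" "y - a \<in> cball 0 (e / 2)"
        by (auto simp: dist_norm norm_minus_commute)
      with that have "y \<in> ?B" by blast
      then show "y \<in> convex hull ?B" by (rule hull_inc)
    qed
  qed auto
qed

section \<open>Semiflows\<close>

locale C1_semiflow = C1_field F X D
  for F :: "real^'n \<Rightarrow> real^'n" and X :: "(real^'n) set" and D :: "'n \<Rightarrow> 'n \<Rightarrow> real^'n \<Rightarrow> real" +
  fixes \<phi> :: "real \<Rightarrow> real^'n \<Rightarrow> real^'n"
  assumes flow_0: "x \<in> X \<Longrightarrow> \<phi> 0 x = x"
    and flow_in: "x \<in> X \<Longrightarrow> 0 \<le> t \<Longrightarrow> \<phi> t x \<in> X"
    and flow_deriv: "x \<in> X \<Longrightarrow> 0 \<le> t \<Longrightarrow>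
      ((\<lambda>t. \<phi> t x) has_vector_derivative F (\<phi> t x)) (at t within {0..})"
begin

lemma flow_curve: "x \<in> X \<Longrightarrow> curve T (\<lambda>t. \<phi> t x)"
  unfolding curve_def
  by (auto intro: flow_in has_vector_derivative_within_subset[OF flow_deriv])

lemma flow_add:
  assumes x: "x \<in> X" and s: "0 \<le> s" and t: "0 \<le> t"
  shows "\<phi> (s + t) x = \<phi> t (\<phi> s x)"
proof (rule curve_unique[of t "\<lambda>r. \<phi> (s + r) x" "\<lambda>r. \<phi> r (\<phi> s x)"])
  show "curve t (\<lambda>r. \<phi> (s + r) x)"
    unfolding curve_def
  proof (intro ballI conjI)
    fix r assume r: "r \<in> {0..t}"
    then show "\<phi> (s + r) x \<in> X" using x s by (auto intro: flow_in)
    have "((\<lambda>t. \<phi> t x) has_derivative (\<lambda>h. h *\<^sub>R F (\<phi> (s + r) x))) (at (s + r) within (\<lambda>r. s + r) ` {0..t})"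
      using r s flow_deriv[OF x, of "s + r", unfolded has_vector_derivative_def]
      by (auto intro: has_derivative_subset)
    moreover have "((\<lambda>r. s + r) has_derivative (\<lambda>h. h)) (at r within {0..t})"
      by (auto intro!: derivative_eq_intros)
    ultimately show "((\<lambda>r. \<phi> (s + r) x) has_vector_derivative F (\<phi> (s + r) x)) (at r within {0..t})"
      unfolding has_vector_derivative_def
      by (rule has_derivative_in_compose[rotated])
  qed
  show "curve t (\<lambda>r. \<phi> r (\<phi> s x))" using x s by (intro flow_curve flow_in)
qed (use assms in \<open>auto simp: flow_0 flow_in\<close>)

lemma flow_agree:
  assumes "upstream_closed P" "x \<in> X" "y \<in> X" "0 \<le> t"
  shows "agree P (\<phi> t x) (\<phi> t y) \<longleftrightarrow> agree P x y"
  using agree_iff[OF assms(1) flow_curve flow_curve, of x y t t] assms(2-4)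
  by (simp add: flow_0)

lemma flow_continuous_time: "x \<in> X \<Longrightarrow> continuous_on {0..} (\<lambda>t. \<phi> t x)"
  by (auto simp: continuous_on_eq_continuous_within
      intro!: has_vector_derivative_continuous[OF flow_deriv])

text \<open>The growth estimate holds as long as the second orbit stays in a fixed compact convex neighborhood
  of the first one.  If it starts close enough, then at the first time of distance \<open>e\<close> the estimate
  itself would give a distance less than \<open>e\<close>.\<close>

lemma flow_lipschitz_near:
  assumes x: "x \<in> X" and T: "0 \<le> T"
  obtains \<delta> L where "0 < \<delta>" "0 \<le> L"
    "\<And>y t. y \<in> X \<Longrightarrow> dist y x < \<delta> \<Longrightarrow> t \<in> {0..T} \<Longrightarrow> dist (\<phi> t y) (\<phi> t x) \<le> L * dist y x"
proof -
  let ?I = "(\<lambda>t. \<phi> t x) ` {0..T}"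
  have "compact ?I"
    by (intro compact_continuous_image continuous_on_subset[OF flow_continuous_time[OF x]]) auto
  moreover have "?I \<subseteq> X" using x by (auto intro: flow_in)
  ultimately obtain K e where e: "0 < e" and K: "compact K" "convex K" "K \<subseteq> X"
    and eK: "\<And>a. a \<in> ?I \<Longrightarrow> cball a e \<subseteq> K" by (rule compact_convex_neighborhood) blast
  obtain M where M: "0 \<le> M" "\<And>i j x. x \<in> K \<Longrightarrow> \<bar>D i j x\<bar> \<le> M" using bound_D K by blast
  define c where "c = 2 * M * real (card (UNIV :: 'n set))"
  define L where "L = exp (c * T)"
  have c: "0 \<le> c" using M by (simp add: c_def)
  have L1: "1 \<le> L" using c T by (simp add: L_def)
  have grow: "dist (\<phi> t y) (\<phi> t x) \<le> L * dist y x"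
    if y: "y \<in> X" and t: "t \<in> {0..T}"
      and le: "\<And>s. s \<in> {0..t} \<Longrightarrow> dist (\<phi> s y) (\<phi> s x) \<le> e" for y t
  proof -
    have dist2: "(\<Sum>i\<in>UNIV. (v $ i - u $ i)\<^sup>2) = (dist v u)\<^sup>2" for u v :: "real^'n"
      by (simp add: dist_vec_def L2_set_def sum_nonneg dist_real_def)
    have "\<phi> s x \<in> K \<and> \<phi> s y \<in> K" if "s \<in> {0..t}" for s
    proof -
      have "cball (\<phi> s x) e \<subseteq> K" using that t by (intro eK) auto
      moreover have "\<phi> s x \<in> cball (\<phi> s x) e" "\<phi> s y \<in> cball (\<phi> s x) e"
        using e le[OF that] by (auto simp: dist_commute)
      ultimately show ?thesis by blast
    qed
    then have "(dist (\<phi> t y) (\<phi> t x))\<^sup>2 \<le> exp (c * t) * (dist (\<phi> 0 y) (\<phi> 0 x))\<^sup>2"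
      using coordinate_growth(1)[OF upstream_closed_UNIV K(2,3) M flow_curve[OF x] flow_curve[OF y], of t t] t
      unfolding c_def dist2 by auto
    also have "\<dots> \<le> L\<^sup>2 * (dist y x)\<^sup>2"
    proof -
      have "exp (c * t) \<le> L" unfolding L_def using c t by (simp add: mult_left_mono)
      also have "L \<le> L\<^sup>2" using L1 by (simp add: power2_eq_square)
      finally show ?thesis using x y by (simp add: flow_0 mult_right_mono)
    qed
    finally have "(dist (\<phi> t y) (\<phi> t x))\<^sup>2 \<le> (L * dist y x)\<^sup>2" by (simp add: power_mult_distrib)
    then show ?thesis by (rule power2_le_imp_le) (use L1 in auto)
  qed
  have "dist (\<phi> t y) (\<phi> t x) \<le> L * dist y x"
    if y: "y \<in> X" and d: "dist y x < e / L" and t: "t \<in> {0..T}" for y t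
  proof -
    let ?g = "\<lambda>t. dist (\<phi> t y) (\<phi> t x)"
    have Ld: "L * dist y x < e" using d L1 by (simp add: field_simps)
    have cont: "continuous_on {0..T} ?g"
      by (intro continuous_intros continuous_on_subset[OF flow_continuous_time] x y) auto
    \<comment> \<open>A point of \<open>?E\<close> would be a time at which the orbits are at least \<open>e\<close> apart.\<close>
    let ?E = "{0..T} \<inter> ?g -` {e..}"
    have "?E = {}"
    proof (rule ccontr)
      assume "?E \<noteq> {}"
      moreover have "compact ?E"
        by (rule compact_eq_bounded_closed[THEN iffD2])
          (auto intro!: continuous_closed_preimage cont bounded_subset[of "{0..T}" ?E])
      ultimately obtain s where s: "s \<in> ?E" "\<And>r. r \<in> ?E \<Longrightarrow> s \<le> r"
        using compact_attains_inf[of ?E] by blast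
      have g0: "?g 0 < e"
      proof -
        have "dist y x \<le> L * dist y x" using L1 by (simp add: mult_le_cancel_right1)
        then show ?thesis using Ld x y by (simp add: flow_0)
      qed
      have "continuous_on {0..s} ?g" using cont s(1) by (auto intro: continuous_on_subset)
      \<comment> \<open>By minimality of \<open>s\<close> the distance at \<open>s\<close> is exactly \<open>e\<close>.\<close>
      then obtain s' where s': "0 \<le> s'" "s' \<le> s" "?g s' = e"
        using IVT'[of ?g 0 e s] g0 s(1) by auto
      then have "s' = s" using s(2)[of s'] s(1) by auto
      have "?g r \<le> e" if "r \<in> {0..s}" for r
      proof (cases "r = s")
        case False
        then show ?thesis using s(2)[of r] s(1) that by fastforce
      qed (use s' \<open>s' = s\<close> in simp)
      then have "?g s \<le> L * dist y x" using s(1) y by (intro grow) auto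
      then show False using Ld s' \<open>s' = s\<close> by simp
    qed
    then have "\<And>s. s \<in> {0..t} \<Longrightarrow> ?g s \<le> e" using t by fastforce
    then show ?thesis using y t by (intro grow) auto
  qed
  then show thesis using e L1 by (intro that[of "e / L" L]) auto
qed

lemma flow_tendsto:
  assumes x: "x \<in> X" and t: "0 \<le> t"
    and \<tau>: "(\<tau> \<longlongrightarrow> t) G" "\<forall>\<^sub>F k in G. 0 \<le> \<tau> k" and \<xi>: "(\<xi> \<longlongrightarrow> x) G"
  shows "((\<lambda>k. \<phi> (\<tau> k) (\<xi> k)) \<longlongrightarrow> \<phi> t x) G"
proof -
  obtain \<delta> L where L: "0 < \<delta>" "0 \<le> L"
    "\<And>y s. y \<in> X \<Longrightarrow> dist y x < \<delta> \<Longrightarrow> s \<in> {0..t + 1} \<Longrightarrow> dist (\<phi> s y) (\<phi> s x) \<le> L * dist y x"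
    using flow_lipschitz_near[OF x, of "t + 1"] t by auto
  have "\<forall>\<^sub>F k in G. \<xi> k \<in> X" using topological_tendstoD[OF \<xi> open_X x] .
  moreover have "\<forall>\<^sub>F k in G. dist (\<xi> k) x < \<delta>" using tendstoD[OF \<xi> L(1)] .
  moreover have "\<forall>\<^sub>F k in G. \<tau> k < t + 1" using \<tau>(1) by (rule order_tendstoD) simp
  ultimately have "\<forall>\<^sub>F k in G. dist (\<phi> (\<tau> k) (\<xi> k)) (\<phi> (\<tau> k) x) \<le> L * dist (\<xi> k) x"
    using \<tau>(2) by eventually_elim (auto intro: L(3))
  moreover have "((\<lambda>k. L * dist (\<xi> k) x) \<longlongrightarrow> 0) G"
    using tendsto_mult_left[OF tendsto_dist[OF \<xi> tendsto_const[of x]], of L] by simp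
  ultimately have "((\<lambda>k. dist (\<phi> (\<tau> k) (\<xi> k)) (\<phi> (\<tau> k) x)) \<longlongrightarrow> 0) G"
    using Lim_null_comparison[of "\<lambda>k. dist (\<phi> (\<tau> k) (\<xi> k)) (\<phi> (\<tau> k) x)"] by simp
  moreover have "((\<lambda>k. \<phi> (\<tau> k) x) \<longlongrightarrow> \<phi> t x) G"
  proof (rule continuous_on_tendsto_compose[OF flow_continuous_time[OF x] \<tau>(1)])
    show "\<forall>\<^sub>F k in G. \<tau> k \<in> {0..}" using \<tau>(2) by simp
  qed (use t in simp)
  ultimately show ?thesis
    using tendsto_add[of "\<lambda>k. \<phi> (\<tau> k) (\<xi> k) - \<phi> (\<tau> k) x" 0 G "\<lambda>k. \<phi> (\<tau> k) x" "\<phi> t x"]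
    by (simp add: dist_norm tendsto_norm_zero_iff)
qed

lemma flow_mult:
  assumes "x \<in> X" "0 \<le> s" "\<phi> s x = x"
  shows "\<phi> (real n * s) x = x"
proof (induction n)
  case (Suc n)
  have "\<phi> (real n * s + s) x = \<phi> s (\<phi> (real n * s) x)"
    using assms by (intro flow_add) auto
  then show ?case using Suc assms by (simp add: algebra_simps)
qed (use assms in \<open>simp add: flow_0\<close>)

end

section \<open>Attractors and equilibria\<close>

text \<open>Attraction is stated by sequences, the form in which it is used.  Since the flow is defined for all
  times on all of \<open>X\<close>, this is a self-contained description of a global attractor.\<close>

locale C1_semiflow_with_attractor = C1_semiflow F X D \<phi>
  for F :: "real^'n \<Rightarrow> real^'n" and X :: "(real^'n) set" and D :: "'n \<Rightarrow> 'n \<Rightarrow> real^'n \<Rightarrow> real"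
    and \<phi> :: "real \<Rightarrow> real^'n \<Rightarrow> real^'n" +
  fixes A :: "(real^'n) set"
  assumes compact_A: "compact A" and A_subset: "A \<subseteq> X"
    and A_invariant: "0 \<le> t \<Longrightarrow> \<phi> t ` A = A"
    and attraction: "x \<in> X \<Longrightarrow> (\<And>k. 0 \<le> \<tau> k) \<Longrightarrow> filterlim \<tau> at_top sequentially \<Longrightarrow>
      \<exists>z\<in>A. \<exists>r. strict_mono r \<and> (\<lambda>k. \<phi> (\<tau> (r k)) x) \<longlonglongrightarrow> z"
    and stable: "open V \<Longrightarrow> A \<subseteq> V \<Longrightarrow>
      \<exists>N W. open W \<and> A \<subseteq> W \<and> W \<subseteq> N \<and> N \<subseteq> V \<and> N \<subseteq> X \<and> (\<forall>x\<in>N. \<forall>t\<ge>0. \<phi> t x \<in> N)"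
begin

lemma flow_in_A: "x \<in> A \<Longrightarrow> 0 \<le> t \<Longrightarrow> \<phi> t x \<in> A"
  using A_invariant by blast

text \<open>Sampled at multiples of its period, a periodic orbit is constant, so the point is its own limit
  point.\<close>

lemma periodic_in_A:
  assumes "x \<in> X" "0 < s" "\<phi> s x = x"
  shows "x \<in> A"
proof -
  have "filterlim (\<lambda>k. real k * s) at_top sequentially"
    using assms(2) by (intro filterlim_at_top_mult_tendsto_pos[OF tendsto_const] filterlim_real_sequentially)
  then obtain z r where "z \<in> A" "(\<lambda>k. \<phi> (real (r k) * s) x) \<longlonglongrightarrow> z"
    using attraction[of x "\<lambda>k. real k * s"] assms by auto
  moreover have "\<phi> (real (r k) * s) x = x" for k
    using assms by (intro flow_mult) auto
  ultimately have "z = x" by (simp add: LIMSEQ_const_iff)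
  with \<open>z \<in> A\<close> show ?thesis by simp
qed

lemma reaches_neighborhood:
  assumes "x \<in> X" "open W" "A \<subseteq> W"
  obtains t where "0 \<le> t" "\<phi> t x \<in> W"
proof -
  obtain z r where "z \<in> A" "(\<lambda>k. \<phi> (real (r k)) x) \<longlonglongrightarrow> z"
    using attraction[OF assms(1), of real] filterlim_real_sequentially by auto
  then have "\<forall>\<^sub>F k in sequentially. \<phi> (real (r k)) x \<in> W"
    using assms topological_tendstoD by blast
  then obtain k where "\<phi> (real (r k)) x \<in> W" using eventually_happens trivial_limit_sequentially by blast
  then show thesis by (intro that[of "real (r k)"]) auto
qed

text \<open>Brouwer's theorem alone would give a fixed point of a map with a long flow time, that is, a
  periodic point.  Making the extra time vanish on \<open>A\<close>, where all periodic points are, turns it into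
  a fixed point for the short time \<open>s\<close>.\<close>

lemma fixed_point_of_time_map:
  assumes Z: "closed Z" "convex Z" "\<forall>x\<in>X \<inter> Z. \<forall>t\<ge>0. \<phi> t x \<in> Z"
    and x0: "x0 \<in> X" "x0 \<in> Z" and s: "0 < s"
  obtains p where "p \<in> A" "p \<in> Z" "\<phi> s p = p"
proof -
  obtain K e where e: "0 < e" and K: "compact K" "convex K" "K \<subseteq> X"
    and eK: "\<And>a. a \<in> A \<Longrightarrow> cball a e \<subseteq> K"
    by (rule compact_convex_neighborhood[OF compact_A A_subset]) blast
  have "\<exists>N W. open W \<and> A \<subseteq> W \<and> W \<subseteq> N \<and> N \<subseteq> (\<Union>a\<in>A. ball a e) \<and> N \<subseteq> X \<and> (\<forall>x\<in>N. \<forall>t\<ge>0. \<phi> t x \<in> N)"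
    using e by (intro stable) auto
  then obtain N W where N: "open W" "A \<subseteq> W" "W \<subseteq> N" "N \<subseteq> (\<Union>a\<in>A. ball a e)" "N \<subseteq> X"
    and N_inv: "\<And>x t. x \<in> N \<Longrightarrow> 0 \<le> t \<Longrightarrow> \<phi> t x \<in> N"
    by metis
  have NK: "N \<subseteq> K"
  proof
    fix y assume "y \<in> N"
    then obtain a where "a \<in> A" "y \<in> cball a e" using N(4) by force
    then show "y \<in> K" using eK by blast
  qed
  have "\<exists>t V. 0 \<le> t \<and> open V \<and> x \<in> V \<and> (\<forall>y. y \<in> V \<longrightarrow> \<phi> t y \<in> W)" if x: "x \<in> X" for x
  proof -
    obtain t where t: "0 \<le> t" "\<phi> t x \<in> W" using reaches_neighborhood[OF x N(1,2)] .
    have "((\<lambda>y. \<phi> t y) \<longlongrightarrow> \<phi> t x) (nhds x)"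
      by (rule flow_tendsto[OF x t(1) tendsto_const _ filterlim_ident]) (simp add: t)
    then have "\<forall>\<^sub>F y in nhds x. \<phi> t y \<in> W" using N(1) t(2) by (rule topological_tendstoD)
    then show ?thesis using t(1) unfolding eventually_nhds by blast
  qed
  then obtain \<theta> V where V: "\<And>x. x \<in> X \<Longrightarrow> 0 \<le> \<theta> x" "\<And>x. x \<in> X \<Longrightarrow> open (V x)"
    "\<And>x. x \<in> X \<Longrightarrow> x \<in> V x" "\<And>x y. x \<in> X \<Longrightarrow> y \<in> V x \<Longrightarrow> \<phi> (\<theta> x) y \<in> W"
    by metis
  have cover: "K \<subseteq> (\<Union>x\<in>K. V x)" using V(3) K(3) by blast
  obtain K' where K': "K' \<subseteq> K" "finite K'" "K \<subseteq> (\<Union>x\<in>K'. V x)"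
    by (rule compactE_image[OF K(1) _ cover]) (use V(2) K(3) in blast)
  \<comment> \<open>The sum of the finitely many entry times bounds each of them.\<close>
  define T where "T = (\<Sum>x\<in>K'. \<theta> x)"
  have T0: "0 \<le> T" using V(1) K' K(3) by (auto simp: T_def intro!: sum_nonneg)
  have T: "\<phi> t y \<in> N" if y: "y \<in> K" and t: "T \<le> t" for y t
  proof -
    obtain x where x: "x \<in> K'" "y \<in> V x" using K' y by blast
    have "\<theta> x \<le> T" unfolding T_def using V(1) K' K(3) x by (intro member_le_sum) auto
    moreover have "x \<in> X" "y \<in> X" using x y K'(1) K(3) by blast+
    then have "\<phi> (\<theta> x) y \<in> N" "0 \<le> \<theta> x" using V(1) V(4)[OF _ x(2)] N(3) by blast+
    ultimately have "\<phi> (\<theta> x + (t - \<theta> x)) y \<in> N"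
      using t \<open>y \<in> X\<close> by (subst flow_add) (simp_all add: N_inv)
    then show ?thesis by simp
  qed
  obtain y0 where y0: "y0 \<in> K" "y0 \<in> Z"
  proof -
    obtain t where "0 \<le> t" "\<phi> t x0 \<in> W" using reaches_neighborhood[OF x0(1) N(1,2)] .
    then show thesis using Z(3) x0 N(3) NK by (intro that[of "\<phi> t x0"]) blast+
  qed
  obtain a0 where "a0 \<in> A"
    using attraction[OF x0(1), of real] filterlim_real_sequentially by auto
  then have A0: "A \<noteq> {}" by blast
  obtain \<delta> where \<delta>: "0 < \<delta>" "\<And>x. infdist x A < \<delta> \<Longrightarrow> x \<in> W"
  proof -
    obtain \<delta> where \<delta>: "0 < \<delta>" "(\<Union>a\<in>A. ball a \<delta>) \<subseteq> W"
      using compact_subset_open_imp_ball_epsilon_subset[OF compact_A N(1,2)] by blast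
    moreover have "x \<in> W" if "infdist x A < \<delta>" for x
    proof -
      obtain a where "a \<in> A" "infdist x A = dist x a"
        using infdist_attains_inf[OF compact_imp_closed[OF compact_A] A0] by blast
      then have "x \<in> ball a \<delta>" using that by (simp add: dist_commute)
      then show ?thesis using \<delta>(2) \<open>a \<in> A\<close> by blast
    qed
    ultimately show thesis using that by blast
  qed
  \<comment> \<open>The extra time is \<open>0\<close> on \<open>A\<close> and \<open>T\<close> outside a neighborhood of \<open>A\<close> contained in \<open>W\<close>.\<close>
  define \<tau> where "\<tau> x = T * min 1 (infdist x A / \<delta>)" for x
  have \<tau>0: "0 \<le> \<tau> x" for x using T0 \<delta>(1) by (simp add: \<tau>_def infdist_nonneg)
  have in_N: "\<phi> (s + \<tau> x) x \<in> N" if x: "x \<in> K" for x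
  proof (cases "infdist x A < \<delta>")
    case True
    then have "x \<in> N" using \<delta>(2) N(3) by blast
    then show ?thesis using \<tau>0[of x] s by (intro N_inv) auto
  next
    case False
    then have "1 \<le> infdist x A / \<delta>" using \<delta>(1) by (simp add: le_divide_eq)
    then have "\<tau> x = T" by (simp add: \<tau>_def)
    then show ?thesis using T[OF x, of "s + \<tau> x"] s by simp
  qed
  have cont: "continuous_on (K \<inter> Z) (\<lambda>x. \<phi> (s + \<tau> x) x)"
    unfolding continuous_on
  proof
    fix x assume "x \<in> K \<inter> Z"
    then have x: "x \<in> X" using K(3) by blast
    have "continuous_on (K \<inter> Z) (\<lambda>x. s + \<tau> x)"
      unfolding \<tau>_def by (intro continuous_intros) (use \<delta>(1) in auto)
    then have "((\<lambda>x. s + \<tau> x) \<longlongrightarrow> s + \<tau> x) (at x within K \<inter> Z)"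
      using \<open>x \<in> K \<inter> Z\<close> unfolding continuous_on by blast
    then show "((\<lambda>x. \<phi> (s + \<tau> x) x) \<longlongrightarrow> \<phi> (s + \<tau> x) x) (at x within K \<inter> Z)"
      using s \<tau>0 by (intro flow_tendsto[OF x] tendsto_ident_at always_eventually allI) (simp_all add: add_nonneg_nonneg)
  qed
  have maps: "(\<lambda>x. \<phi> (s + \<tau> x) x) \<in> K \<inter> Z \<rightarrow> K \<inter> Z"
  proof
    fix x assume x: "x \<in> K \<inter> Z"
    then have "x \<in> X \<inter> Z" "0 \<le> s + \<tau> x" using K(3) s \<tau>0[of x] by auto
    then have "\<phi> (s + \<tau> x) x \<in> Z" using Z(3) by blast
    then show "\<phi> (s + \<tau> x) x \<in> K \<inter> Z" using in_N[of x] NK x by auto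
  qed
  have KZ: "compact (K \<inter> Z)" "convex (K \<inter> Z)" "K \<inter> Z \<noteq> {}"
    using compact_Int_closed[OF K(1) Z(1)] convex_Int[OF K(2) Z(2)] y0 by auto
  obtain p where p: "p \<in> K \<inter> Z" "\<phi> (s + \<tau> p) p = p"
    by (rule brouwer[OF KZ cont maps])
  have pA: "p \<in> A"
  proof (rule periodic_in_A)
    show "p \<in> X" using p(1) K(3) by blast
    show "0 < s + \<tau> p" using s \<tau>0[of p] by linarith
  qed (rule p(2))
  then have "\<tau> p = 0" by (simp add: \<tau>_def infdist_zero)
  then have "\<phi> s p = p" using p(2) by simp
  then show thesis using p(1) by (intro that[OF pA]) simp
qed

text \<open>Fixed points \<open>p\<^sub>k\<close> of the time-\<open>1/(k+1)\<close> maps lie in the compact set \<open>A\<close>.  A limit point is fixed for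
  every time \<open>t\<close>, since \<open>t\<close> is a limit of integer multiples of \<open>1/(k+1)\<close>.\<close>

lemma exists_equilibrium_in_invariant_convex:
  assumes Z: "closed Z" "convex Z" "\<forall>x\<in>X \<inter> Z. \<forall>t\<ge>0. \<phi> t x \<in> Z"
    and x0: "x0 \<in> X" "x0 \<in> Z"
  shows "\<exists>p\<in>X \<inter> Z. \<forall>t\<ge>0. \<phi> t p = p"
proof -
  have "\<exists>p. p \<in> A \<inter> Z \<and> \<phi> (1 / real (Suc k)) p = p" for k
  proof -
    have k: "0 < 1 / real (Suc k)" by simp
    obtain p where "p \<in> A" "p \<in> Z" "\<phi> (1 / real (Suc k)) p = p"
      by (rule fixed_point_of_time_map[OF Z x0 k])
    then show ?thesis by blast
  qed
  then obtain p where p: "\<And>k. p k \<in> A \<inter> Z" "\<And>k. \<phi> (1 / real (Suc k)) (p k) = p k" by metis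
  have "compact (A \<inter> Z)" using compact_A Z(1) by (rule compact_Int_closed)
  then obtain q r where q: "q \<in> A \<inter> Z" "strict_mono r" "(p \<circ> r) \<longlonglongrightarrow> q"
    using p(1) seq_compactE[of "A \<inter> Z" p] unfolding compact_eq_seq_compact_metric by blast
  have qX: "q \<in> X" using q A_subset by blast
  have "\<phi> t q = q" if t: "0 \<le> t" for t
  proof -
    \<comment> \<open>\<open>\<tau> k\<close> is the largest multiple of \<open>1 / (r k + 1)\<close> that is at most \<open>t\<close>.\<close>
    define m where "m k = nat \<lfloor>t * real (Suc (r k))\<rfloor>" for k
    define \<tau> where "\<tau> k = real (m k) * (1 / real (Suc (r k)))" for k
    have fixed: "\<phi> (\<tau> k) (p (r k)) = p (r k)" for k
      unfolding \<tau>_def using p[of "r k"] A_subset by (intro flow_mult) auto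
    have "\<tau> \<longlonglongrightarrow> t"
    proof (rule Lim_transform2[OF tendsto_const])
      have "norm (t - \<tau> k) \<le> inverse (real (Suc (r k)))" for k
      proof -
        define n where "n = real (Suc (r k))"
        have n: "0 < n" by (simp add: n_def)
        have floor: "real (nat \<lfloor>a\<rfloor>) \<le> a \<and> a \<le> real (nat \<lfloor>a\<rfloor>) + 1" if "0 \<le> a" for a :: real
          using that by linarith
        have "real (m k) \<le> t * n \<and> t * n \<le> real (m k) + 1"
          unfolding m_def n_def[symmetric] using t n by (intro floor) simp
        then have "real (m k) / n \<le> t" "t \<le> (real (m k) + 1) / n"
          using n by (simp_all add: divide_le_eq le_divide_eq)
        then have "norm (t - real (m k) * (1 / n)) \<le> inverse n"
          by (simp add: add_divide_distrib inverse_eq_divide)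
        then show ?thesis unfolding \<tau>_def n_def .
      qed
      then have "\<forall>\<^sub>F k in sequentially. norm (t - \<tau> k) \<le> inverse (real (Suc (r k)))"
        by (intro always_eventually allI)
      moreover have "(\<lambda>k. inverse (real (Suc (r k)))) \<longlonglongrightarrow> 0"
        using LIMSEQ_subseq_LIMSEQ[OF LIMSEQ_inverse_real_of_nat q(2)] by (simp only: o_def)
      ultimately show "(\<lambda>k. t - \<tau> k) \<longlonglongrightarrow> 0"
        by (rule Lim_null_comparison)
    qed
    moreover have "\<forall>\<^sub>F k in sequentially. 0 \<le> \<tau> k"
      by (intro always_eventually) (simp add: \<tau>_def)
    ultimately have "(\<lambda>k. \<phi> (\<tau> k) ((p \<circ> r) k)) \<longlonglongrightarrow> \<phi> t q"
      using q(3) by (intro flow_tendsto[OF qX t])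
    then have "(p \<circ> r) \<longlonglongrightarrow> \<phi> t q" by (simp add: fixed o_def)
    then show ?thesis using LIMSEQ_unique[of "p \<circ> r" q "\<phi> t q"] q(3) by (simp add: o_def)
  qed
  with qX q(1) show ?thesis by (intro bexI[of _ q]) auto
qed

end

section \<open>Cooperative blocks\<close>

text \<open>The order of the orthant with signs \<open>\<sigma>\<close>, on the coordinates \<open>C\<close> only; it is a preorder, and points
  equivalent for it agree on \<open>C\<close>.\<close>

definition orthant_le :: "('n \<Rightarrow> real) \<Rightarrow> 'n set \<Rightarrow> real^'n \<Rightarrow> real^'n \<Rightarrow> bool" where
  "orthant_le \<sigma> C x y \<longleftrightarrow> (\<forall>i\<in>C. \<sigma> i * x $ i \<le> \<sigma> i * y $ i)"

lemma orthant_le_refl: "orthant_le \<sigma> C x x"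
  and orthant_le_trans: "orthant_le \<sigma> C x y \<Longrightarrow> orthant_le \<sigma> C y z \<Longrightarrow> orthant_le \<sigma> C x z"
  by (force simp: orthant_le_def)+

lemma orthant_le_agree: "agree C x y \<Longrightarrow> orthant_le \<sigma> C x y"
  by (simp add: agree_def orthant_le_def)

lemma orthant_le_antisym:
  assumes "orthant_le \<sigma> C x y" "orthant_le \<sigma> C y x" "\<And>i. \<sigma> i \<noteq> 0"
  shows "agree C x y"
proof -
  have "\<sigma> i * x $ i = \<sigma> i * y $ i" if "i \<in> C" for i
    using assms(1,2) that unfolding orthant_le_def by (intro antisym) blast+
  then show ?thesis using assms(3) by (simp add: agree_def)
qed

lemma orthant_le_tendsto:
  assumes "(u \<longlongrightarrow> x) G" "(v \<longlongrightarrow> y) G" "\<forall>\<^sub>F k in G. orthant_le \<sigma> C (u k) (v k)" "G \<noteq> bot"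
  shows "orthant_le \<sigma> C x y"
  unfolding orthant_le_def
proof
  fix i assume i: "i \<in> C"
  have "((\<lambda>k. \<sigma> i * u k $ i) \<longlongrightarrow> \<sigma> i * x $ i) G" "((\<lambda>k. \<sigma> i * v k $ i) \<longlongrightarrow> \<sigma> i * y $ i) G"
    by (rule tendsto_mult_left tendsto_vec_nth assms(1,2))+
  moreover have "\<forall>\<^sub>F k in G. \<sigma> i * u k $ i \<le> \<sigma> i * v k $ i"
    using assms(3) by (rule eventually_mono) (use i in \<open>simp add: orthant_le_def\<close>)
  ultimately show "\<sigma> i * x $ i \<le> \<sigma> i * y $ i" by (intro tendsto_le[OF assms(4)])
qed

text \<open>One step of the cascade: \<open>S\<close> collects the coordinates upstream of \<open>C\<close>, and after the change of signs
  \<open>\<sigma>\<close> the coordinates in \<open>C\<close> do not inhibit each other.\<close>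

definition (in C1_field) cooperative_block :: "('n \<Rightarrow> real) \<Rightarrow> 'n set \<Rightarrow> 'n set \<Rightarrow> bool" where
  "cooperative_block \<sigma> S C \<longleftrightarrow>
    upstream_closed S \<and> upstream_closed (S \<union> C) \<and> S \<inter> C = {} \<and> (\<forall>i. \<bar>\<sigma> i\<bar> = 1) \<and>
    (\<forall>i\<in>C. \<forall>j\<in>C. i \<noteq> j \<longrightarrow> (\<forall>x\<in>X. 0 \<le> \<sigma> i * \<sigma> j * D i j x))"

context C1_semiflow begin

lemma flow_mono:
  assumes "cooperative_block \<sigma> S C" "x \<in> X" "y \<in> X" "agree S x y" "orthant_le \<sigma> C x y" "0 \<le> t"
  shows "orthant_le \<sigma> C (\<phi> t x) (\<phi> t y)"
  unfolding orthant_le_def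
proof
  fix i assume i: "i \<in> C"
  show "\<sigma> i * \<phi> t x $ i \<le> \<sigma> i * \<phi> t y $ i"
    by (rule monotone_curves[where S = S and C = C and u = "\<lambda>t. \<phi> t x" and v = "\<lambda>t. \<phi> t y" and T = t])
      (use assms i in \<open>auto simp: cooperative_block_def agree_def orthant_le_def flow_0 intro: flow_curve\<close>)
qed

text \<open>If \<open>\<phi>\<^sub>T x\<close> is strictly below \<open>x\<close>, then \<open>\<phi>\<^sub>s x\<close> is below \<open>x\<close> for all \<open>s\<close> in some interval
  \<open>[T, T + e)\<close>, and by monotonicity so is \<open>\<phi>\<^sub>t x\<close> for every multiple \<open>t = n s\<close>.  These multiples cover
  all large times.\<close>

lemma eventually_below_start:
  assumes coop: "cooperative_block \<sigma> S C" and x: "x \<in> X"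
    and S: "\<And>t. 0 \<le> t \<Longrightarrow> agree S (\<phi> t x) x"
    and T: "0 < T" "\<And>i. i \<in> C \<Longrightarrow> \<sigma> i * \<phi> T x $ i < \<sigma> i * x $ i"
  shows "\<exists>t0\<ge>0. \<forall>t\<ge>t0. orthant_le \<sigma> C (\<phi> t x) x"
proof -
  have "\<exists>e>0. \<forall>s. T \<le> s \<and> s < T + e \<longrightarrow> orthant_le \<sigma> C (\<phi> s x) x"
  proof -
    have "\<forall>\<^sub>F s in at_right T. \<sigma> i * \<phi> s x $ i < \<sigma> i * x $ i" if i: "i \<in> C" for i
    proof -
      have "((\<lambda>s. \<phi> s x) \<longlongrightarrow> \<phi> T x) (at_right T)"
        using T(1) x by (intro flow_tendsto tendsto_ident_at tendsto_const)
          (auto simp: eventually_at_filter)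
      then have "((\<lambda>s. \<sigma> i * \<phi> s x $ i) \<longlongrightarrow> \<sigma> i * \<phi> T x $ i) (at_right T)"
        by (intro tendsto_mult_left tendsto_vec_nth)
      then show ?thesis by (rule order_tendstoD) (rule T(2)[OF i])
    qed
    then have "\<forall>\<^sub>F s in at_right T. \<forall>i\<in>C. \<sigma> i * \<phi> s x $ i < \<sigma> i * x $ i"
      by (intro eventually_ball_finite) auto
    then obtain b where b: "T < b" "\<And>s. T < s \<Longrightarrow> s < b \<Longrightarrow> \<forall>i\<in>C. \<sigma> i * \<phi> s x $ i < \<sigma> i * x $ i"
      unfolding eventually_at_right_field by blast
    have "orthant_le \<sigma> C (\<phi> s x) x" if "T \<le> s" "s < T + (b - T)" for s
    proof (cases "s = T")
      case True then show ?thesis using T(2) by (simp add: orthant_le_def less_imp_le)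
    next
      case False then show ?thesis using b(2)[of s] that by (simp add: orthant_le_def less_imp_le)
    qed
    then show ?thesis using b(1) by (intro exI[of _ "b - T"]) simp
  qed
  then obtain e where e: "0 < e" "\<And>s. T \<le> s \<Longrightarrow> s < T + e \<Longrightarrow> orthant_le \<sigma> C (\<phi> s x) x" by blast
  have iter: "orthant_le \<sigma> C (\<phi> (real n * s) x) x" if s: "T \<le> s" "s < T + e" for s n
  proof (induction n)
    case 0 show ?case using x by (simp add: flow_0 orthant_le_refl)
  next
    case (Suc n)
    have s0: "0 \<le> s" using T(1) s by simp
    then have "\<phi> (real (Suc n) * s) x = \<phi> s (\<phi> (real n * s) x)"
      using flow_add[OF x, of "real n * s" s] by (simp add: algebra_simps)
    moreover have "orthant_le \<sigma> C (\<phi> s (\<phi> (real n * s) x)) (\<phi> s x)"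
      using s0 x Suc by (intro flow_mono[OF coop] flow_in S) auto
    ultimately show ?case using e(2)[OF s] by (auto intro: orthant_le_trans)
  qed
  obtain N where N: "T / e < real N" using reals_Archimedean2 by blast
  have "orthant_le \<sigma> C (\<phi> t x) x" if t: "T * real (Suc N) \<le> t" for t
  proof -
    \<comment> \<open>With \<open>n\<close> large, \<open>t / n\<close> exceeds \<open>T\<close> by less than \<open>e\<close>.\<close>
    define n where "n = nat \<lfloor>t / T\<rfloor>"
    have "real (Suc N) \<le> t / T" using t T(1) by (simp add: le_divide_eq mult.commute)
    then have "Suc N \<le> n" unfolding n_def by (simp add: le_nat_floor)
    have n: "real n \<le> t / T" "t / T < real n + 1"
      using \<open>real (Suc N) \<le> t / T\<close> unfolding n_def by linarith+
    have n0: "0 < real n" "T / e < real n" using \<open>Suc N \<le> n\<close> N by auto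
    have "T \<le> t / real n" using n(1) n0 T(1) by (simp add: field_simps)
    moreover have "t / real n < T + e"
    proof -
      have "t < T * real n + T" using n(2) T(1) by (simp add: field_simps)
      moreover have "T < e * real n" using n0(2) e(1) by (simp add: divide_less_eq mult.commute)
      ultimately have "t < (T + e) * real n" by (simp add: distrib_right)
      then show ?thesis using n0(1) by (simp add: divide_less_eq)
    qed
    ultimately have "orthant_le \<sigma> C (\<phi> (real n * (t / real n)) x) x" by (rule iter)
    then show ?thesis using n0(1) by simp
  qed
  moreover have "0 \<le> T * real (Suc N)" using T(1) by simp
  ultimately show ?thesis by blast
qed

text \<open>Here \<open>\<phi>\<^sub>w x\<close> is below \<open>\<phi>\<^sub>u x\<close> whenever \<open>w \<ge> u + t\<^sub>0\<close>.  Hence each limit point lies below every point of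
  the orbit, so below every other limit point, and any two limit points agree on \<open>C\<close>.  This is applied
  to \<open>z\<close> and \<open>\<phi>\<^sub>s z\<close>.\<close>

lemma limit_stationary_if_below_start:
  assumes coop: "cooperative_block \<sigma> S C" and x: "x \<in> X"
    and S: "\<And>t. 0 \<le> t \<Longrightarrow> agree S (\<phi> t x) x"
    and below: "0 \<le> t0" "\<And>t. t0 \<le> t \<Longrightarrow> orthant_le \<sigma> C (\<phi> t x) x"
    and m: "\<And>k. 0 \<le> m k" "filterlim m at_top sequentially"
    and z: "(\<lambda>k. \<phi> (m k) x) \<longlonglongrightarrow> z" "z \<in> X" and s: "0 \<le> s"
  shows "agree C (\<phi> s z) z"
proof -
  have step: "orthant_le \<sigma> C (\<phi> w x) (\<phi> u x)" if "0 \<le> u" "u + t0 \<le> w" for u w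
  proof -
    have "orthant_le \<sigma> C (\<phi> u (\<phi> (w - u) x)) (\<phi> u x)"
      using that below x by (intro flow_mono[OF coop] flow_in S below(2)) auto
    moreover have "\<phi> u (\<phi> (w - u) x) = \<phi> w x"
      using flow_add[OF x, of "w - u" u] that below(1) by simp
    ultimately show ?thesis by simp
  qed
  have shift: "(\<lambda>k. \<phi> (m k + s) x) \<longlonglongrightarrow> \<phi> s z"
  proof -
    have "(\<lambda>k. \<phi> s (\<phi> (m k) x)) \<longlonglongrightarrow> \<phi> s z"
      using s by (intro flow_tendsto[OF z(2) s tendsto_const _ z(1)]) simp
    then show ?thesis using m(1) s by (simp add: flow_add[OF x])
  qed
  have late: "\<forall>\<^sub>F l in sequentially. b \<le> m l" for b
    using m(2) by (simp add: filterlim_at_top)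
  have z_below: "orthant_le \<sigma> C z (\<phi> u x)" if "0 \<le> u" for u
    by (rule orthant_le_tendsto[OF z(1) tendsto_const])
      (use late[of "u + t0"] that in \<open>auto elim!: eventually_mono intro: step\<close>)
  have sz_below: "orthant_le \<sigma> C (\<phi> s z) (\<phi> u x)" if "0 \<le> u" for u
    by (rule orthant_le_tendsto[OF shift tendsto_const])
      (use late[of "u + t0"] that s in \<open>auto elim!: eventually_mono intro: step\<close>)
  have "orthant_le \<sigma> C z (\<phi> s z)"
    by (rule orthant_le_tendsto[OF tendsto_const shift])
      (use m(1) s in \<open>auto intro!: always_eventually z_below\<close>)
  moreover have "orthant_le \<sigma> C (\<phi> s z) z"
    by (rule orthant_le_tendsto[OF tendsto_const z(1)])
      (use m(1) in \<open>auto intro!: always_eventually sz_below\<close>)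
  moreover have "\<sigma> i \<noteq> 0" for i
  proof -
    have "\<bar>\<sigma> i\<bar> = 1" using coop by (simp add: cooperative_block_def)
    then show ?thesis by auto
  qed
  ultimately show ?thesis by (intro orthant_le_antisym[of \<sigma>])
qed

end

context C1_semiflow_with_attractor begin

text \<open>The points of the backward orbit of \<open>a\<close> are maximal as well, by injectivity of the flow.  The
  orbit of a point \<open>x\<close> slightly above a limit point of the backward orbit is squeezed between the
  backward orbit and the attractor, so it returns close to the backward orbit, hence strictly
  below \<open>x\<close>.\<close>

lemma maximal_point_stationary:
  assumes coop: "cooperative_block \<sigma> S C"
    and A_S: "\<And>a b. a \<in> A \<Longrightarrow> b \<in> A \<Longrightarrow> agree S a b"
    and a: "a \<in> A" and max: "\<forall>b\<in>A. orthant_le \<sigma> C a b \<longrightarrow> agree C a b"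
    and s: "0 \<le> s"
  shows "agree (S \<union> C) (\<phi> s a) a"
proof -
  have upS: "upstream_closed S" and upSC: "upstream_closed (S \<union> C)" and disj: "S \<inter> C = {}"
    and sign: "\<And>i. \<bar>\<sigma> i\<bar> = 1"
    using coop by (auto simp: cooperative_block_def)
  have AX: "b \<in> X" if "b \<in> A" for b using that A_subset by blast
  have "\<exists>b\<in>A. \<phi> (real k) b = a" for k
  proof -
    have "a \<in> \<phi> (real k) ` A" using A_invariant[of "real k"] a by simp
    then show ?thesis by auto
  qed
  then obtain y where y: "\<And>k. y k \<in> A" "\<And>k. \<phi> (real k) (y k) = a" by metis
  obtain c r where c: "c \<in> A" "strict_mono (r :: nat \<Rightarrow> nat)" "(y \<circ> r) \<longlonglongrightarrow> c"
    by (rule seq_compactE[of A y]) (use compact_A y(1) in \<open>auto simp: compact_eq_seq_compact_metric\<close>)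
  \<comment> \<open>The direction of the interior of the orthant, and \<open>0\<close> off \<open>C\<close>, so that \<open>x\<close> keeps the
    \<open>S\<close>-coordinates of \<open>c\<close>.\<close>
  define v :: "real^'n" where "v = (\<chi> i. if i \<in> C then \<sigma> i else 0)"
  obtain e where e: "0 < e" "ball c e \<subseteq> X" using open_X AX[OF c(1)] open_contains_ball by blast
  define \<eta> where "\<eta> = e / (2 * (norm v + 1))"
  have den: "0 < 2 * (norm v + 1)" by (intro mult_pos_pos add_nonneg_pos norm_ge_zero) simp_all
  have \<eta>: "0 < \<eta>" using e(1) den by (simp add: \<eta>_def)
  define x where "x = c + \<eta> *\<^sub>R v"
  have x: "x \<in> X"
  proof -
    have less: "norm v / (2 * (norm v + 1)) < 1"
      using den add_nonneg_pos[OF norm_ge_zero[of v] zero_less_one] by (simp add: divide_less_eq)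
    have "norm (\<eta> *\<^sub>R v) = \<eta> * norm v" using \<eta> by simp
    also have "\<dots> = e * (norm v / (2 * (norm v + 1)))" by (simp add: \<eta>_def)
    also have "\<dots> < e * 1" using less e(1) by (rule mult_strict_left_mono)
    finally have "x \<in> ball c e" by (simp add: x_def dist_norm)
    then show ?thesis using e(2) by blast
  qed
  have sq: "\<sigma> i * \<sigma> i = 1" for i using sign[of i] by (metis abs_mult_self_eq mult_1)
  have x_C: "\<sigma> i * x $ i = \<sigma> i * c $ i + \<eta>" if "i \<in> C" for i
    using that sq[of i] by (simp add: x_def v_def distrib_left mult.left_commute[of "\<sigma> i" \<eta>])
  have x_S: "agree S x b" if "b \<in> A" for b
  proof -
    have "agree S x c" using disj by (auto simp: agree_def x_def v_def)
    then show ?thesis using A_S[OF c(1) that] by (rule agree_trans)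
  qed
  have flow_S: "agree S (\<phi> t x) x" if "0 \<le> t" for t
  proof -
    have "agree S (\<phi> t x) (\<phi> t c)" using flow_agree[OF upS x AX[OF c(1)] that] x_S[OF c(1)] by simp
    then show ?thesis using x_S[OF flow_in_A[OF c(1) that]] by (blast intro: agree_trans agree_sym)
  qed
  have "\<forall>\<^sub>F k in sequentially. \<forall>i\<in>C. \<sigma> i * (y \<circ> r) k $ i < \<sigma> i * x $ i"
  proof (intro eventually_ball_finite ballI)
    fix i assume i: "i \<in> C"
    have "(\<lambda>k. \<sigma> i * (y \<circ> r) k $ i) \<longlonglongrightarrow> \<sigma> i * c $ i"
      by (rule tendsto_mult_left[OF tendsto_vec_nth[OF c(3)]])
    moreover have "\<sigma> i * c $ i < \<sigma> i * x $ i" using x_C[OF i] \<eta> by simp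
    ultimately show "\<forall>\<^sub>F k in sequentially. \<sigma> i * (y \<circ> r) k $ i < \<sigma> i * x $ i"
      by (rule order_tendstoD)
  qed simp
  then obtain K0 where K0: "\<And>k i. K0 \<le> k \<Longrightarrow> i \<in> C \<Longrightarrow> \<sigma> i * y (r k) $ i < \<sigma> i * x $ i"
    by (auto simp: eventually_sequentially)
  \<comment> \<open>From \<open>K0\<close> on, the backward orbit is strictly below \<open>x\<close>; \<open>\<phi>\<close> takes the time \<open>n\<close> to lead from its
    point number \<open>K0\<close> to \<open>a\<close>, and \<open>\<tau> k\<close> to lead from number \<open>K0 + k\<close> to number \<open>K0\<close>.\<close>
  define n where "n = real (r K0)"
  define \<tau> where "\<tau> k = real (r (K0 + k)) - n" for k
  have \<tau>0: "0 \<le> \<tau> k" for k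
    using strict_mono_mono[OF c(2)] by (simp add: \<tau>_def n_def mono_def)
  have \<tau>_lim: "filterlim \<tau> at_top sequentially"
  proof -
    have "real k - n \<le> \<tau> k" for k
      using strict_mono_imp_increasing[OF c(2), of "K0 + k"] by (simp add: \<tau>_def)
    moreover have "filterlim (\<lambda>k. - n + real k) at_top sequentially"
      by (rule filterlim_tendsto_add_at_top[OF tendsto_const filterlim_real_sequentially])
    ultimately show ?thesis by (elim filterlim_at_top_mono) (simp add: always_eventually)
  qed
  obtain z \<rho> where z: "z \<in> A" "strict_mono \<rho>" "(\<lambda>k. \<phi> (\<tau> (\<rho> k)) x) \<longlonglongrightarrow> z"
    using attraction[OF x \<tau>0 \<tau>_lim] by blast
  have n0: "0 \<le> n" by (simp add: n_def)
  have above_a: "orthant_le \<sigma> C a (\<phi> n (\<phi> (\<tau> k) x))" for k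
  proof -
    have "orthant_le \<sigma> C (\<phi> (real (r (K0 + k))) (y (r (K0 + k)))) (\<phi> (real (r (K0 + k))) x)"
      using K0[of "K0 + k"]
      by (intro flow_mono[OF coop AX[OF y(1)] x agree_sym[OF x_S[OF y(1)]]])
        (auto simp: orthant_le_def less_imp_le)
    then have "orthant_le \<sigma> C a (\<phi> (\<tau> k + n) x)" by (simp add: y(2) \<tau>_def)
    then show ?thesis using flow_add[OF x \<tau>0 n0] by simp
  qed
  \<comment> \<open>A limit point of the orbit of \<open>x\<close> in \<open>A\<close> and above \<open>a\<close>; by maximality it agrees with \<open>a\<close>
    on \<open>C\<close>.\<close>
  define w where "w = \<phi> n z"
  have wA: "w \<in> A" unfolding w_def using z(1) n0 by (rule flow_in_A)
  have w_lim: "(\<lambda>k. \<phi> n (\<phi> (\<tau> (\<rho> k)) x)) \<longlonglongrightarrow> w"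
    unfolding w_def by (rule flow_tendsto[OF AX[OF z(1)] n0 tendsto_const _ z(3)]) (simp add: n0)
  have "orthant_le \<sigma> C a w"
    by (rule orthant_le_tendsto[OF tendsto_const w_lim]) (simp_all add: above_a)
  then have aw: "agree (S \<union> C) a w" using max wA A_S[OF a wA] by (simp add: agree_Un)
  \<comment> \<open>Injectivity of the flow on the coordinates \<open>S \<union> C\<close>.\<close>
  have "agree (S \<union> C) (y (r K0)) z"
    using aw flow_agree[OF upSC AX[OF y(1)[of "r K0"]] AX[OF z(1)] n0] y(2)[of "r K0"]
    by (simp add: w_def n_def)
  then have z_less: "\<sigma> i * z $ i < \<sigma> i * x $ i" if "i \<in> C" for i
    using K0[of K0 i] that by (auto simp: agree_def)
  have "\<forall>\<^sub>F k in sequentially. \<forall>i\<in>C. \<sigma> i * \<phi> (\<tau> (\<rho> k)) x $ i < \<sigma> i * x $ i"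
  proof (intro eventually_ball_finite ballI)
    fix i assume i: "i \<in> C"
    have "(\<lambda>k. \<sigma> i * \<phi> (\<tau> (\<rho> k)) x $ i) \<longlonglongrightarrow> \<sigma> i * z $ i"
      by (rule tendsto_mult_left[OF tendsto_vec_nth[OF z(3)]])
    then show "\<forall>\<^sub>F k in sequentially. \<sigma> i * \<phi> (\<tau> (\<rho> k)) x $ i < \<sigma> i * x $ i"
      using z_less[OF i] by (rule order_tendstoD)
  qed simp
  moreover have \<tau>\<rho>_lim: "filterlim (\<lambda>k. \<tau> (\<rho> k)) at_top sequentially"
    using filterlim_compose[OF \<tau>_lim filterlim_subseq[OF z(2)]] .
  then have "\<forall>\<^sub>F k in sequentially. 0 < \<tau> (\<rho> k)" by (simp add: filterlim_at_top_dense)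
  ultimately have "\<forall>\<^sub>F k in sequentially. 0 < \<tau> (\<rho> k) \<and> (\<forall>i\<in>C. \<sigma> i * \<phi> (\<tau> (\<rho> k)) x $ i < \<sigma> i * x $ i)"
    by (simp add: eventually_conj_iff)
  then obtain k where k: "0 < \<tau> (\<rho> k)" "\<And>i. i \<in> C \<Longrightarrow> \<sigma> i * \<phi> (\<tau> (\<rho> k)) x $ i < \<sigma> i * x $ i"
    using eventually_happens trivial_limit_sequentially by blast
  have "\<exists>t0\<ge>0. \<forall>t\<ge>t0. orthant_le \<sigma> C (\<phi> t x) x"
    by (rule eventually_below_start[OF coop x flow_S k])
  then obtain t0 where t0: "0 \<le> t0" "\<And>t. t0 \<le> t \<Longrightarrow> orthant_le \<sigma> C (\<phi> t x) x" by blast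
  have "agree C (\<phi> s w) w"
  proof (rule limit_stationary_if_below_start[OF coop x flow_S t0 _ _ _ AX[OF wA] s])
    show "0 \<le> \<tau> (\<rho> k) + n" for k using \<tau>0[of "\<rho> k"] n0 by simp
    show "filterlim (\<lambda>k. \<tau> (\<rho> k) + n) at_top sequentially"
      using filterlim_tendsto_add_at_top[OF tendsto_const[of n] \<tau>\<rho>_lim] by (simp add: add.commute)
    show "(\<lambda>k. \<phi> (\<tau> (\<rho> k) + n) x) \<longlonglongrightarrow> w"
      using w_lim by (simp add: flow_add[OF x \<tau>0 n0])
  qed
  moreover have "agree (S \<union> C) (\<phi> s a) (\<phi> s w)"
    using flow_agree[OF upSC AX[OF a] AX[OF wA] s] aw by simp
  ultimately have "agree C (\<phi> s a) a"
    using aw unfolding agree_Un by (blast intro: agree_trans agree_sym)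
  then show ?thesis using A_S[OF flow_in_A[OF a s] a] by (simp add: agree_Un)
qed

text \<open>Maximize the strictly increasing function \<open>\<Sum>i\<in>C. \<sigma>\<^sub>i x\<^sub>i\<close> over the compact set of points of \<open>A\<close> above
  \<open>b\<close>.\<close>

lemma exists_maximal_above:
  assumes b: "b \<in> A" and \<sigma>: "\<forall>i. \<sigma> i \<noteq> 0"
  shows "\<exists>a\<in>A. orthant_le \<sigma> C b a \<and> (\<forall>b'\<in>A. orthant_le \<sigma> C a b' \<longrightarrow> agree C a b')"
proof -
  let ?B = "A \<inter> {x. \<forall>i\<in>C. \<sigma> i * b $ i \<le> \<sigma> i * x $ i}"
  let ?h = "\<lambda>x :: real^'n. \<Sum>i\<in>C. \<sigma> i * x $ i"
  have "closed {x :: real^'n. \<sigma> i * b $ i \<le> \<sigma> i * x $ i}" for i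
    by (intro closed_Collect_le continuous_intros)
  then have "closed (\<Inter>i\<in>C. {x :: real^'n. \<sigma> i * b $ i \<le> \<sigma> i * x $ i})" by (intro closed_INT) auto
  then have "closed {x :: real^'n. \<forall>i\<in>C. \<sigma> i * b $ i \<le> \<sigma> i * x $ i}"
    by (simp add: Collect_ball_eq)
  then have "compact ?B" using compact_A by (rule compact_Int_closed[rotated])
  moreover have "?B \<noteq> {}" using b by auto
  moreover have "continuous_on ?B ?h" by (intro continuous_intros)
  ultimately obtain a where a: "a \<in> ?B" "\<And>x. x \<in> ?B \<Longrightarrow> ?h x \<le> ?h a"
    using continuous_attains_sup[of ?B ?h] by blast
  show ?thesis
  proof (intro bexI[of _ a] conjI ballI impI)
    show "a \<in> A" "orthant_le \<sigma> C b a" using a(1) by (auto simp: orthant_le_def)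
    fix x assume x: "x \<in> A" "orthant_le \<sigma> C a x"
    then have "x \<in> ?B" using a(1) by (force simp: orthant_le_def)
    then have "(\<Sum>i\<in>C. \<sigma> i * x $ i - \<sigma> i * a $ i) \<le> 0" using a(2) by (simp add: sum_subtractf)
    moreover have "0 \<le> \<sigma> i * x $ i - \<sigma> i * a $ i" if "i \<in> C" for i
      using x(2) that by (simp add: orthant_le_def)
    ultimately have "\<forall>i\<in>C. \<sigma> i * x $ i - \<sigma> i * a $ i = 0"
      by (metis (no_types, lifting) finite_code sum_nonneg sum_nonneg_eq_0_iff order_antisym)
    then show "agree C a x" using \<sigma> by (simp add: agree_def)
  qed
qed

text \<open>A maximal point is stationary on \<open>S \<union> C\<close>, so the points that agree with it there form an invariant
  convex set, and the equilibrium in this set is \<open>q\<close>.  Every point of \<open>A\<close> lies between a minimal and a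
  maximal point, both of which agree with \<open>q\<close>.\<close>

lemma block_collapses:
  assumes coop: "cooperative_block \<sigma> S C"
    and A_S: "\<And>a b. a \<in> A \<Longrightarrow> b \<in> A \<Longrightarrow> agree S a b"
    and unique: "\<forall>p\<in>X. (\<forall>t\<ge>0. \<phi> t p = p) \<longrightarrow> p = q"
    and b: "b \<in> A"
  shows "agree (S \<union> C) b q"
proof -
  have upSC: "upstream_closed (S \<union> C)" using coop by (simp add: cooperative_block_def)
  have maximal: "agree (S \<union> C) a q"
    if coop': "cooperative_block \<sigma>' S C" and a: "a \<in> A"
      and max: "\<forall>b\<in>A. orthant_le \<sigma>' C a b \<longrightarrow> agree C a b" for a \<sigma>'
  proof -
    define Z where "Z = {x. agree (S \<union> C) x a}"
    have Z_eq: "Z = (\<Inter>i\<in>S \<union> C. {x. x $ i = a $ i})" by (auto simp: Z_def agree_def)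
    have aX: "a \<in> X" using a A_subset by blast
    have inv: "\<forall>x\<in>X \<inter> Z. \<forall>t\<ge>0. \<phi> t x \<in> Z"
    proof (intro ballI allI impI)
      fix x t assume x: "x \<in> X \<inter> Z" and t: "0 \<le> (t :: real)"
      have "agree (S \<union> C) (\<phi> t x) (\<phi> t a)"
        using flow_agree[OF upSC _ aX t, of x] x by (simp add: Z_def)
      moreover have "agree (S \<union> C) (\<phi> t a) a"
        by (rule maximal_point_stationary[OF coop' A_S a max t])
      ultimately show "\<phi> t x \<in> Z" unfolding Z_def by (blast intro: agree_trans)
    qed
    have Z_closed: "closed Z" unfolding Z_eq by (intro closed_INT ballI closed_Collect_eq continuous_intros)
    have Z_convex: "convex Z"
      unfolding Z_eq by (intro convex_INT) (auto simp: convex_def algebra_simps simp flip: distrib_right)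
    have aZ: "a \<in> Z" by (simp add: Z_def agree_refl)
    obtain p where p: "p \<in> X" "p \<in> Z" "\<And>t. 0 \<le> t \<Longrightarrow> \<phi> t p = p"
      using exists_equilibrium_in_invariant_convex[OF Z_closed Z_convex inv aX aZ] by blast
    have "p = q" using unique p(1,3) by blast
    then show ?thesis using p(2) by (simp add: Z_def agree_sym)
  qed
  have sign: "\<forall>i. \<sigma> i \<noteq> 0"
  proof
    fix i
    have "\<bar>\<sigma> i\<bar> = 1" using coop by (simp add: cooperative_block_def)
    then show "\<sigma> i \<noteq> 0" by auto
  qed
  have sign': "\<forall>i. - \<sigma> i \<noteq> 0" using sign by simp
  have coop_neg: "cooperative_block (\<lambda>i. - \<sigma> i) S C" using coop by (simp add: cooperative_block_def)
  obtain a where a: "a \<in> A" "orthant_le \<sigma> C b a" "\<forall>b'\<in>A. orthant_le \<sigma> C a b' \<longrightarrow> agree C a b'"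
    using exists_maximal_above[OF b sign, where C = C] by blast
  obtain a' where a': "a' \<in> A" "orthant_le (\<lambda>i. - \<sigma> i) C b a'"
    "\<forall>b'\<in>A. orthant_le (\<lambda>i. - \<sigma> i) C a' b' \<longrightarrow> agree C a' b'"
    using exists_maximal_above[OF b sign', where C = C] by blast
  have aq: "agree (S \<union> C) a q" by (rule maximal[OF coop a(1,3)])
  have a'q: "agree (S \<union> C) a' q" by (rule maximal[OF coop_neg a'(1,3)])
  have "orthant_le \<sigma> C a' b" using a'(2) by (simp add: orthant_le_def)
  moreover have "agree C a a'" using aq a'q by (auto simp: agree_def)
  ultimately have "orthant_le \<sigma> C a b" by (blast intro: orthant_le_agree orthant_le_trans)
  then have "agree C b a" using a(2) sign by (intro orthant_le_antisym) auto
  moreover have "agree S b a" using A_S[OF b a(1)] .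
  ultimately have "agree (S \<union> C) b a" by (simp add: agree_Un)
  then show ?thesis using aq by (rule agree_trans)
qed

end

text \<open>Going down the cascade: a maximal upstream closed set of coordinates on which \<open>A\<close> is constant is
  the set of all coordinates, since otherwise the next block could be added.\<close>

lemma (in C1_semiflow_with_attractor) attractor_collapses:
  assumes blocks: "\<And>S. upstream_closed S \<Longrightarrow> S \<noteq> UNIV \<Longrightarrow> \<exists>\<sigma> C. C \<noteq> {} \<and> cooperative_block \<sigma> S C"
    and q: "q \<in> X" "\<And>t. 0 \<le> t \<Longrightarrow> \<phi> t q = q"
    and unique: "\<forall>p\<in>X. (\<forall>t\<ge>0. \<phi> t p = p) \<longrightarrow> p = q"
  shows "A = {q}"
proof -
  let ?\<S> = "{S. upstream_closed S \<and> (\<forall>a\<in>A. \<forall>b\<in>A. agree S a b)}"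
  have "{} \<in> ?\<S>" by (simp add: upstream_closed_def agree_def)
  then have "\<exists>S\<in>?\<S>. \<forall>S'\<in>?\<S>. S \<subseteq> S' \<longrightarrow> S = S'"
    by (intro finite_has_maximal) auto
  then obtain S where S_in: "S \<in> ?\<S>" and S_max: "\<forall>S'\<in>?\<S>. S \<subseteq> S' \<longrightarrow> S = S'" by blast
  have S: "upstream_closed S" "\<And>a b. a \<in> A \<Longrightarrow> b \<in> A \<Longrightarrow> agree S a b"
    using S_in by auto
  have "S = UNIV"
  proof (rule ccontr)
    assume "S \<noteq> UNIV"
    then obtain \<sigma> C where C: "C \<noteq> {}" and coop: "cooperative_block \<sigma> S C"
      using blocks[OF S(1)] by blast
    have "agree (S \<union> C) b q" if "b \<in> A" for b
      by (rule block_collapses[OF coop S(2) unique that])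
    then have "agree (S \<union> C) a b" if "a \<in> A" "b \<in> A" for a b
      using that by (meson agree_sym agree_trans)
    moreover have up: "upstream_closed (S \<union> C)" and disj: "S \<inter> C = {}"
      using coop by (simp_all add: cooperative_block_def)
    ultimately have "S \<union> C \<in> ?\<S>" by simp
    then have "S = S \<union> C" using S_max by blast
    then show False using C disj by blast
  qed
  then have "a = b" if "a \<in> A" "b \<in> A" for a b
    using S(2)[OF that] by (simp add: agree_def vec_eq_iff)
  moreover have "q \<in> A" using q by (intro periodic_in_A[of q 1]) auto
  ultimately show ?thesis by blast
qed

section \<open>Coherent interaction graphs\<close>

primrec walk :: "('n \<times> 'n) set \<Rightarrow> 'n \<Rightarrow> ('n \<times> 'n) list \<Rightarrow> 'n \<Rightarrow> bool" where
  "walk E u [] v \<longleftrightarrow> u = v"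
| "walk E u (e # es) v \<longleftrightarrow> e \<in> E \<and> fst e = u \<and> walk E (snd e) es v"

lemma walk_append: "walk E u es v \<Longrightarrow> walk E v fs w \<Longrightarrow> walk E u (es @ fs) w"
  by (induction es arbitrary: u) auto

lemma walk_if_reachable: "(u, v) \<in> E\<^sup>* \<Longrightarrow> \<exists>es. walk E u es v"
proof (induction rule: converse_rtrancl_induct)
  case base
  have "walk E v [] v" by simp
  then show ?case by blast
next
  case (step y z)
  then obtain es where "walk E z es v" by blast
  then have "walk E y ((y, z) # es) v" using step by simp
  then show ?case by blast
qed

lemma walk_edges: "walk E u es v \<Longrightarrow> set es \<subseteq> E"
  by (induction es arbitrary: u) auto

lemma walk_endpoints: "walk E u es v \<Longrightarrow> es \<noteq> [] \<Longrightarrow> fst (hd es) = u \<and> snd (last es) = v"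
  by (induction es arbitrary: u) (auto split: if_splits)

lemma walk_consecutive: "walk E u es v \<Longrightarrow> Suc k < length es \<Longrightarrow> snd (es ! k) = fst (es ! Suc k)"
proof (induction es arbitrary: u k)
  case (Cons e es)
  show ?case
  proof (cases k)
    case 0
    then show ?thesis using Cons.prems walk_endpoints[of E "snd e" es v] by (cases es) auto
  next
    case (Suc k')
    then show ?thesis using Cons by auto
  qed
qed simp

definition walk_sign :: "(real^'n \<Rightarrow> real^'n) \<Rightarrow> (real^'n) set \<Rightarrow> ('n \<times> 'n) list \<Rightarrow> int" where
  "walk_sign F X es = prod_list (map (\<lambda>e. the (edge_label F X e)) es)"

lemma walk_sign_append: "walk_sign F X (es @ fs) = walk_sign F X es * walk_sign F X fs"
  by (simp add: walk_sign_def)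

text \<open>The interaction graph has no edges from a vertex to itself, so a nonempty closed walk has length at
  least \<open>2\<close> and is a loop; the empty walk has sign \<open>1\<close>.\<close>

lemma closed_walk_positive:
  assumes "coherent F X" "walk (interaction_edges F X) u es u"
  shows "walk_sign F X es = 1" "\<And>e. e \<in> set es \<Longrightarrow> edge_label F X e \<noteq> None"
proof -
  have *: "positive_loop F X es" if "es \<noteq> []"
  proof -
    have "length es \<ge> 2"
    proof (rule ccontr)
      assume "\<not> 2 \<le> length es"
      with that obtain e where "es = [e]" by (cases es; cases "tl es") auto
      then have "e \<in> interaction_edges F X" "fst e = snd e" using assms(2) by auto
      then show False by (auto simp: interaction_edges_def)
    qed
    then have "graph_loop F X es"
      using that walk_edges[OF assms(2)] walk_endpoints[OF assms(2)] walk_consecutive[OF assms(2)]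
      by (auto simp: graph_loop_def)
    then show ?thesis using assms(1) by (simp add: coherent_def)
  qed
  then show "walk_sign F X es = 1"
    by (cases "es = []") (auto simp: positive_loop_def walk_sign_def)
  show "edge_label F X e \<noteq> None" if "e \<in> set es" for e
    using * that by (cases "es = []") (auto simp: positive_loop_def)
qed

lemma edge_label_sign:
  assumes "edge_label F X (j, i) = Some l" "x \<in> X"
  shows "0 \<le> real_of_int l * partial_deriv F X i j x"
  using assms by (auto simp: edge_label_def split: if_splits)

text \<open>Among the vertices outside \<open>S\<close> choose \<open>i\<close> with the fewest ancestors.  Its ancestors outside \<open>S\<close> have the
  same set of ancestors, hence they are all reachable from \<open>i\<close>; they form the block \<open>C\<close>.  The sign of
  \<open>j\<close> in \<open>C\<close> is the sign of any walk from \<open>i\<close> to \<open>j\<close>.  Closing up walks to loops shows that this sign is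
  \<open>\<plusminus>1\<close> and that it changes along an edge inside \<open>C\<close> exactly by the label of the edge.\<close>

lemma exists_cooperative_block:
  assumes field: "C1_field F X (partial_deriv F X)" and coh: "coherent F X"
    and S: "C1_field.upstream_closed X (partial_deriv F X) S" "S \<noteq> UNIV"
  shows "\<exists>\<sigma> C. C \<noteq> {} \<and> C1_field.cooperative_block X (partial_deriv F X) \<sigma> S C"
proof -
  interpret C1_field F X "partial_deriv F X" by (rule field)
  let ?E = "interaction_edges F X"
  have upstream: "upstream_closed P \<longleftrightarrow> (\<forall>i\<in>P. \<forall>j. (j, i) \<in> ?E \<longrightarrow> j \<in> P)" for P
  proof -
    have edge: "(j, i) \<in> ?E \<longleftrightarrow> j \<noteq> i \<and> (\<exists>x\<in>X. partial_deriv F X i j x \<noteq> 0)" for i j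
      by (auto simp: interaction_edges_def)
    show ?thesis unfolding upstream_closed_def edge by metis
  qed
  \<comment> \<open>\<open>rtrancl\<close> makes every vertex its own ancestor, so \<open>i\<close> itself belongs to the block.\<close>
  define anc where "anc i = {j. (j, i) \<in> ?E\<^sup>*}" for i
  have anc_mono: "anc j \<subseteq> anc i" if "j \<in> anc i" for i j
    using that unfolding anc_def by (auto intro: rtrancl_trans)
  obtain i0 where "i0 \<notin> S" using S(2) by blast
  then obtain i where i: "i \<notin> S" "\<And>j. j \<notin> S \<Longrightarrow> card (anc i) \<le> card (anc j)"
    using ex_has_least_nat[of "\<lambda>i. i \<notin> S" i0 "\<lambda>i. card (anc i)"] by blast
  define C where "C = anc i - S"
  have iC: "i \<in> C" using i(1) by (simp add: C_def anc_def)
  have to_i: "(j, i) \<in> ?E\<^sup>*" if "j \<in> C" for j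
    using that by (simp add: C_def anc_def)
  have from_i: "(i, j) \<in> ?E\<^sup>*" if "j \<in> C" for j
  proof -
    have "j \<in> anc i" "j \<notin> S" using that by (simp_all add: C_def)
    then have "anc j = anc i" by (intro card_seteq anc_mono i(2) finite)
    moreover have "i \<in> anc i" by (simp add: anc_def)
    ultimately have "i \<in> anc j" by simp
    then show ?thesis by (simp add: anc_def)
  qed
  have "\<exists>es. walk ?E i es j" if "j \<in> C" for j
    by (rule walk_if_reachable[OF from_i[OF that]])
  then obtain out where out: "\<And>j. j \<in> C \<Longrightarrow> walk ?E i (out j) j" by metis
  have "\<exists>es. walk ?E j es i" if "j \<in> C" for j
    by (rule walk_if_reachable[OF to_i[OF that]])
  then obtain ret where ret: "\<And>j. j \<in> C \<Longrightarrow> walk ?E j (ret j) i" by metis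
  let ?s = "\<lambda>j. walk_sign F X (out j)"
  have inverse: "?s j * walk_sign F X (ret j) = 1" if "j \<in> C" for j
    using closed_walk_positive(1)[OF coh walk_append[OF out[OF that] ret[OF that]]]
    by (simp add: walk_sign_append)
  \<comment> \<open>A factorization of \<open>1\<close> in the integers.\<close>
  have unit: "\<bar>?s j\<bar> = 1" if "j \<in> C" for j
    using zmult_eq_1_iff[THEN iffD1, OF inverse[OF that]] by auto
  define \<sigma> where "\<sigma> j = (if j \<in> C then real_of_int (?s j) else 1)" for j
  have "cooperative_block \<sigma> S C"
    unfolding cooperative_block_def
  proof (intro conjI allI ballI impI)
    show "upstream_closed S" by (rule S(1))
    have "j \<in> S \<union> C" if "(j, k) \<in> ?E" "k \<in> C" for j k
    proof -
      have "(j, i) \<in> ?E\<^sup>*" using that(1) to_i[OF that(2)] by (rule converse_rtrancl_into_rtrancl)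
      then show ?thesis by (simp add: C_def anc_def)
    qed
    then show "upstream_closed (S \<union> C)" using S(1) unfolding upstream by blast
    show "S \<inter> C = {}" by (auto simp: C_def)
    show "\<bar>\<sigma> j\<bar> = 1" for j
    proof (cases "j \<in> C")
      case True
      then have "real_of_int \<bar>?s j\<bar> = 1" using unit by simp
      then show ?thesis using True by (simp add: \<sigma>_def)
    qed (simp add: \<sigma>_def)
    fix k j x assume kj: "k \<in> C" "j \<in> C" "k \<noteq> j" and x: "x \<in> X"
    show "0 \<le> \<sigma> k * \<sigma> j * partial_deriv F X k j x"
    proof (cases "(j, k) \<in> ?E")
      case False
      then show ?thesis using kj(3) x by (auto simp: interaction_edges_def)
    next
      case True
      \<comment> \<open>A loop through \<open>i\<close> that uses the given edge; compare it with the loop \<open>out k @ ret k\<close>.\<close>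
      have "walk ?E i (out j @ (j, k) # ret k) i"
        using out[OF kj(2)] ret[OF kj(1)] True by (intro walk_append) auto
      note loop = closed_walk_positive[OF coh this]
      obtain l where l: "edge_label F X (j, k) = Some l" using loop(2)[of "(j, k)"] by auto
      have "?s j * (l * walk_sign F X (ret k)) = 1"
        using loop(1) l by (simp add: walk_sign_def)
      then have "?s j * l = ?s k" using inverse[OF kj(1)]
        by (metis mult.assoc mult.commute mult.right_neutral)
      moreover have "?s j * ?s j = 1" using unit[OF kj(2)] by (metis abs_mult_self_eq mult_1)
      ultimately have "?s k * ?s j = l" by (metis mult.assoc mult.commute mult.right_neutral)
      then have "real_of_int (?s k * ?s j) = real_of_int l" by simp
      then have "\<sigma> k * \<sigma> j = real_of_int l" using kj by (simp add: \<sigma>_def)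
      then show ?thesis using edge_label_sign[OF l x] by simp
    qed
  qed
  then show ?thesis using iC by blast
qed

section \<open>Maximal solutions and global existence\<close>

text \<open>On the open set \<open>X\<close> the field coincides with its \<open>C\<^sup>1\<close> extension, and so do the derivatives.\<close>

lemma C1_field_of_system:
  assumes "dyn_system F X" "open X"
  shows "C1_field F X (partial_deriv F X)"
proof -
  obtain U G G' where U: "open U" "X \<subseteq> U" and eq: "\<And>x. x \<in> X \<Longrightarrow> G x = F x"
    and G: "\<And>x. x \<in> U \<Longrightarrow> (G has_derivative blinfun_apply (G' x)) (at x)" "continuous_on U G'"
    using assms(1) unfolding dyn_system_def C1_on_def by blast
  have der: "(F has_derivative blinfun_apply (G' x)) (at x)" if "x \<in> X" for x
    by (rule has_derivative_transform_within_open[OF G(1) assms(2) that eq]) (use that U in auto)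
  have pd: "partial_deriv F X i j x = blinfun_apply (G' x) (axis j 1) $ i" if "x \<in> X" for x i j
    using frechet_derivative_at[OF der[OF that]] at_within_open[OF that assms(2)]
    by (simp add: partial_deriv_def)
  show ?thesis
  proof
    show "open X" "convex X" using assms by (auto simp: dyn_system_def)
    show "(F has_derivative (\<lambda>h. \<chi> i. \<Sum>j\<in>UNIV. partial_deriv F X i j x * h $ j)) (at x)"
      if x: "x \<in> X" for x
    proof -
      have "blinfun_apply (G' x) h = (\<chi> i. \<Sum>j\<in>UNIV. partial_deriv F X i j x * h $ j)" for h
      proof -
        have "blinfun_apply (G' x) h = blinfun_apply (G' x) (\<Sum>j\<in>UNIV. h $ j *\<^sub>R axis j 1)"
          using basis_expansion[of h] by (simp add: scalar_mult_eq_scaleR)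
        also have "\<dots> = (\<Sum>j\<in>UNIV. h $ j *\<^sub>R blinfun_apply (G' x) (axis j 1))"
          by (simp add: blinfun.sum_right blinfun.scaleR_right)
        finally show ?thesis by (simp add: vec_eq_iff pd[OF x] mult.commute)
      qed
      then have "blinfun_apply (G' x) = (\<lambda>h. \<chi> i. \<Sum>j\<in>UNIV. partial_deriv F X i j x * h $ j)"
        by (rule ext)
      then show ?thesis using der[OF x] by (simp only:)
    qed
    show "continuous_on X (partial_deriv F X i j)" for i j
    proof -
      have "continuous_on X (\<lambda>x. blinfun_apply (G' x) (axis j 1) $ i)"
        by (intro continuous_intros continuous_on_subset[OF G(2) U(2)])
      then show ?thesis by (rule continuous_on_eq) (simp add: pd)
    qed
  qed
qed

lemma solution_interval: "solution F X a J u \<Longrightarrow> t \<in> J \<Longrightarrow> {0..t} \<subseteq> J"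
  unfolding solution_def is_interval_1 by (meson atLeastAtMost_iff subsetI)

lemma (in C1_field) solution_curve:
  assumes "solution F X a J u" "t \<in> J"
  shows "curve t u"
  unfolding curve_def
proof (intro ballI conjI)
  fix s assume "s \<in> {0..t}"
  then have "s \<in> J" using solution_interval[OF assms] by blast
  then show "u s \<in> X" "(u has_vector_derivative F (u s)) (at s within {0..t})"
    using assms(1) solution_interval[OF assms]
    by (auto simp: solution_def intro: has_vector_derivative_within_subset)
qed

lemma (in C1_field) solution_unique:
  assumes "solution F X a J u" "solution F X a J' v" "t \<in> J" "t \<in> J'"
  shows "u t = v t"
proof (rule curve_unique[OF solution_curve[OF assms(1,3)] solution_curve[OF assms(2,4)]])
  show "u 0 = v 0" using assms by (simp add: solution_def)
  show "t \<in> {0..t}" using assms by (auto simp: solution_def)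
qed

text \<open>Intervals that start at \<open>0\<close> are nested, and by uniqueness the solution on the larger one extends the
  other.\<close>

lemma (in C1_field) maximal_domain_unique:
  assumes "maximal_solution F X a J u" "maximal_solution F X a J' v"
  shows "J = J'"
proof -
  have sol: "solution F X a J u" "solution F X a J' v"
    using assms by (simp_all add: maximal_solution_def)
  have "J \<subseteq> J' \<or> J' \<subseteq> J"
  proof (rule ccontr)
    assume "\<not> (J \<subseteq> J' \<or> J' \<subseteq> J)"
    then obtain s t where st: "s \<in> J" "s \<notin> J'" "t \<in> J'" "t \<notin> J" by blast
    have "0 \<le> s" "0 \<le> t" using st sol by (auto simp: solution_def)
    then have "s \<in> {0..t} \<or> t \<in> {0..s}" by auto
    then show False
      using solution_interval[OF sol(1) st(1)] solution_interval[OF sol(2) st(3)] st by blast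
  qed
  then show ?thesis
  proof
    assume sub: "J \<subseteq> J'"
    then have "\<forall>t\<in>J. v t = u t" using solution_unique[OF sol(2,1)] by blast
    then have "J' = J" using assms(1) sol(2) sub unfolding maximal_solution_def by blast
    then show ?thesis by simp
  next
    assume sub: "J' \<subseteq> J"
    then have "\<forall>t\<in>J'. u t = v t" using solution_unique[OF sol] by blast
    then show ?thesis using assms(2) sol(1) sub unfolding maximal_solution_def by blast
  qed
qed

lemma (in C1_field) flow_dom_iff:
  assumes "maximal_solution F X a J u" "a \<in> X"
  shows "a \<in> flow_dom F X t \<longleftrightarrow> t \<in> J"
proof
  assume "a \<in> flow_dom F X t"
  then obtain J' v where "maximal_solution F X a J' v" "t \<in> J'" unfolding flow_dom_def by blast
  then show "t \<in> J" using maximal_domain_unique[OF assms(1)] by simp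
qed (use assms in \<open>auto simp: flow_dom_def\<close>)

lemma (in C1_field) flow_eq:
  assumes "maximal_solution F X a J u" "t \<in> J"
  shows "flow F X t a = u t"
  unfolding flow_def
proof (rule the_equality)
  show "\<exists>J v. maximal_solution F X a J v \<and> t \<in> J \<and> v t = u t" using assms by blast
  fix y assume "\<exists>J v. maximal_solution F X a J v \<and> t \<in> J \<and> v t = y"
  then obtain J' v where v: "maximal_solution F X a J' v" "t \<in> J'" "v t = y" by blast
  have "v t = u t"
    by (rule solution_unique[OF _ _ v(2) assms(2), of a]) (use v(1) assms(1) in \<open>simp_all add: maximal_solution_def\<close>)
  then show "y = u t" using v(3) by simp
qed

lemma solution_shift:
  assumes "solution F X a J u" "t \<in> J"
  shows "solution F X (u t) {s. 0 \<le> s \<and> t + s \<in> J} (\<lambda>s. u (t + s))"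
  unfolding solution_def
proof (intro conjI ballI)
  have J: "is_interval J" "J \<subseteq> {0..}" and der: "\<And>t. t \<in> J \<Longrightarrow> (u has_vector_derivative F (u t)) (at t within J)"
    using assms(1) by (auto simp: solution_def)
  show "is_interval {s. 0 \<le> s \<and> t + s \<in> J}"
    unfolding is_interval_1
  proof (intro ballI allI impI)
    fix x y z :: real
    assume "x \<in> {s. 0 \<le> s \<and> t + s \<in> J}" "y \<in> {s. 0 \<le> s \<and> t + s \<in> J}" "x \<le> z \<and> z \<le> y"
    then have "t + x \<in> J" "t + y \<in> J" "t + x \<le> t + z" "t + z \<le> t + y" "0 \<le> z" by auto
    then show "z \<in> {s. 0 \<le> s \<and> t + s \<in> J}" using mem_is_interval_1_I[OF J(1)] by blast
  qed
  show "0 \<in> {s. 0 \<le> s \<and> t + s \<in> J}" using assms(2) by simp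
  fix s assume s: "s \<in> {s. 0 \<le> s \<and> t + s \<in> J}"
  then show "u (t + s) \<in> X" using assms(1) by (simp add: solution_def)
  let ?J' = "{s. 0 \<le> s \<and> t + s \<in> J}"
  have "(u has_derivative (\<lambda>h. h *\<^sub>R F (u (t + s)))) (at (t + s) within (\<lambda>s. t + s) ` ?J')"
    using der[of "t + s"] s unfolding has_vector_derivative_def
    by (auto elim!: has_derivative_subset)
  moreover have "((\<lambda>s. t + s) has_derivative (\<lambda>h. h)) (at s within ?J')"
    by (auto intro!: derivative_eq_intros)
  ultimately show "((\<lambda>s. u (t + s)) has_vector_derivative F (u (t + s))) (at s within ?J')"
    unfolding has_vector_derivative_def by (rule has_derivative_in_compose[rotated])
qed auto

text \<open>Two solutions, the second starting where the first one is at time \<open>t\<close>, combine to a single solution.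
  At \<open>t\<close> itself the one-sided derivatives coincide, because the field has one value there.\<close>

lemma solution_append:
  assumes u: "solution F X a J u" "t \<in> J" and w: "solution F X (u t) J' w"
  shows "solution F X a ({0..t} \<union> (\<lambda>s. t + s) ` J') (\<lambda>r. if r \<in> {0..t} then u r else w (r - t))"
proof -
  let ?T = "(\<lambda>s. t + s) ` J'"
  let ?v = "\<lambda>r. if r \<in> {0..t} then u r else w (r - t)"
  have J': "is_interval J'" "0 \<in> J'" "J' \<subseteq> {0..}" "w 0 = u t"
    and der_w: "\<And>s. s \<in> J' \<Longrightarrow> w s \<in> X \<and> (w has_vector_derivative F (w s)) (at s within J')"
    using w by (auto simp: solution_def)
  have t0: "0 \<le> t" using u by (auto simp: solution_def)
  have sub: "{0..t} \<subseteq> J" by (rule solution_interval[OF u])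
  have der_u: "u s \<in> X \<and> (u has_vector_derivative F (u s)) (at s within {0..t})" if "s \<in> {0..t}" for s
  proof -
    have "s \<in> J" using sub that by blast
    then have "u s \<in> X" "(u has_vector_derivative F (u s)) (at s within J)"
      using u(1) by (simp_all add: solution_def)
    then show ?thesis using sub by (auto intro: has_vector_derivative_within_subset)
  qed
  have T_iff: "r \<in> ?T \<longleftrightarrow> r - t \<in> J'" for r by (auto intro: image_eqI[of _ _ "r - t"])
  have T_ge: "t \<le> r" if "r \<in> ?T" for r using that J'(3) by auto
  have "closure ?T \<subseteq> {t..}" using T_ge by (intro closure_minimal) auto
  then have cl: "closure {0..t} \<inter> closure ?T \<subseteq> {t}" by auto
  \<comment> \<open>The two pieces of the domain meet in \<open>t\<close> only.\<close>
  have int: "{0..t} \<union> (closure {0..t} \<inter> closure ?T) = {0..t}"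
    "?T \<union> (closure {0..t} \<inter> closure ?T) = ?T"
    using cl t0 J'(2) by (auto simp: T_iff)
  show ?thesis
    unfolding solution_def
  proof (intro conjI ballI)
    show "is_interval ({0..t} \<union> ?T)"
      unfolding is_interval_1
    proof (intro ballI allI impI)
      fix x y z :: real
      assume x: "x \<in> {0..t} \<union> ?T" and y: "y \<in> {0..t} \<union> ?T" and z: "x \<le> z \<and> z \<le> y"
      have "0 \<le> x" using x T_ge t0 by (cases "x \<in> {0..t}") (auto intro: order.trans)
      show "z \<in> {0..t} \<union> ?T"
      proof (cases "z \<le> t")
        case True
        then show ?thesis using z \<open>0 \<le> x\<close> by auto
      next
        case False
        then have "y - t \<in> J'" using y z by (auto simp: T_iff)
        then have "z - t \<in> J'"
          using mem_is_interval_1_I[OF J'(1,2) \<open>y - t \<in> J'\<close>] z False by simp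
        then show ?thesis by (simp add: T_iff)
      qed
    qed
    show "0 \<in> {0..t} \<union> ?T" using t0 by simp
    show "{0..t} \<union> ?T \<subseteq> {0..}" using T_ge t0 by (auto intro: order.trans)
    show "?v 0 = a" using t0 u(1) by (simp add: solution_def)
    fix r assume r: "r \<in> {0..t} \<union> ?T"
    then show "?v r \<in> X" using der_u der_w by (auto simp: T_iff)
    have "(?v has_vector_derivative (if r \<in> {0..t} then F (u r) else F (w (r - t))))
        (at r within {0..t} \<union> ?T)"
    proof (rule has_vector_derivative_If_within_closures[OF r refl, unfolded int])
      show "(u has_vector_derivative F (u r)) (at r within {0..t})" if "r \<in> {0..t}"
        using der_u[OF that] by simp
      show "((\<lambda>r. w (r - t)) has_vector_derivative F (w (r - t))) (at r within ?T)" if "r \<in> ?T"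
      proof -
        have "(w has_derivative (\<lambda>h. h *\<^sub>R F (w (r - t)))) (at (r - t) within (\<lambda>r. r - t) ` ?T)"
          using der_w[of "r - t"] that unfolding has_vector_derivative_def T_iff
          by (simp add: image_image)
        moreover have "((\<lambda>r. r - t) has_derivative (\<lambda>h. h)) (at r within ?T)"
          by (auto intro!: derivative_eq_intros)
        ultimately show ?thesis
          unfolding has_vector_derivative_def by (rule has_derivative_in_compose[rotated])
      qed
      show "u r = w (r - t)" "F (u r) = F (w (r - t))" if "r \<in> closure {0..t}" "r \<in> closure ?T"
        using that cl J'(4) by auto
    qed
    then show "(?v has_vector_derivative F (?v r)) (at r within {0..t} \<union> ?T)"
      by (simp only: if_distrib[of F])
  qed
qed

text \<open>A proper extension of the shifted solution, appended to the part of \<open>u\<close> before \<open>t\<close>, would be a proper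
  extension of \<open>u\<close>.\<close>

lemma (in C1_field) maximal_solution_shift:
  assumes max: "maximal_solution F X a J u" and t: "t \<in> J"
  shows "maximal_solution F X (u t) {s. 0 \<le> s \<and> t + s \<in> J} (\<lambda>s. u (t + s))"
  unfolding maximal_solution_def
proof (intro conjI allI impI)
  have u: "solution F X a J u" using max by (simp add: maximal_solution_def)
  then show "solution F X (u t) {s. 0 \<le> s \<and> t + s \<in> J} (\<lambda>s. u (t + s))"
    using t by (rule solution_shift)
  fix J' w assume asm: "solution F X (u t) J' w \<and> {s. 0 \<le> s \<and> t + s \<in> J} \<subseteq> J' \<and>
    (\<forall>s\<in>{s. 0 \<le> s \<and> t + s \<in> J}. w s = u (t + s))"
  let ?J = "{0..t} \<union> (\<lambda>s. t + s) ` J'"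
  let ?v = "\<lambda>r. if r \<in> {0..t} then u r else w (r - t)"
  have app: "solution F X a ?J ?v" using asm by (intro solution_append[OF u t]) simp
  have sub: "J \<subseteq> ?J"
  proof
    fix r assume r: "r \<in> J"
    then have "0 \<le> r" using u by (auto simp: solution_def)
    show "r \<in> ?J"
    proof (cases "r \<le> t")
      case False
      then have "r - t \<in> J'" using asm r by auto
      then have "t + (r - t) \<in> (\<lambda>s. t + s) ` J'" by (rule imageI)
      then show ?thesis by simp
    qed (use \<open>0 \<le> r\<close> in simp)
  qed
  then have "\<forall>r\<in>J. ?v r = u r" using solution_unique[OF app u] by blast
  then have "?J = J" using max app sub unfolding maximal_solution_def by blast
  moreover have "J' \<subseteq> {0..}" using asm by (simp add: solution_def)
  ultimately have "J' \<subseteq> {s. 0 \<le> s \<and> t + s \<in> J}" by auto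
  then show "J' = {s. 0 \<le> s \<and> t + s \<in> J}" using asm by blast
qed

lemma (in C1_field) orbit_eq:
  assumes max: "maximal_solution F X a J u" and a: "a \<in> X"
  shows "orbit F X a = u ` J"
proof -
  have "J \<subseteq> {0..}" using max by (simp add: maximal_solution_def solution_def)
  then show ?thesis
    using flow_dom_iff[OF max a] flow_eq[OF max] unfolding orbit_def by force
qed

lemma global_solution_maximal:
  "solution F X a {0..} u \<Longrightarrow> maximal_solution F X a {0..} u"
  by (auto simp: maximal_solution_def solution_def)

text \<open>The times provided by positive invariance belong to domains of maximal solutions from the same
  point, and these domains are equal.\<close>

lemma (in C1_field) global_solution_in_positively_invariant:
  assumes N: "positively_invariant F X N" and a: "a \<in> N"
  obtains w where "solution F X a {0..} w"
proof -
  have dom: "a \<in> flow_dom F X t" if "0 \<le> t" for t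
    using N a that unfolding positively_invariant_def by blast
  have aX: "a \<in> X" using N a unfolding positively_invariant_def by blast
  obtain J w where max: "maximal_solution F X a J w" using dom[of 0] unfolding flow_dom_def by blast
  have "{0..} \<subseteq> J" using dom unfolding flow_dom_iff[OF max aX] by auto
  moreover have "J \<subseteq> {0..}" and "solution F X a J w"
    using max by (simp_all add: maximal_solution_def solution_def)
  ultimately show thesis by (intro that[of w]) (simp add: antisym)
qed

text \<open>The condition \<open>omega_limit F X a \<subseteq> A\<close> with compact \<open>A\<close> is informative in two ways.  It excludes that
  no maximal solution starts at \<open>a\<close>, since then the intersection over no times would be the whole space.
  And as the closures of the forward orbits are nested compact sets, their intersection is not
  empty, so the orbit comes close to \<open>A\<close>, even if its domain is bounded.  From there on it can
  be continued inside \<open>N\<close>.\<close>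

lemma (in C1_field) global_solution_if_attracted:
  assumes att: "attracts F X A a" and a: "a \<in> X" and A: "compact A"
    and W: "open W" "A \<subseteq> W" "W \<subseteq> N" and N: "positively_invariant F X N"
  obtains w where "solution F X a {0..} w"
proof -
  have "omega_limit F X a \<noteq> UNIV"
    using att compact_imp_bounded[OF A] not_bounded_UNIV bounded_subset unfolding attracts_def by metis
  then obtain t where "a \<in> flow_dom F X t" unfolding omega_limit_def by blast
  then obtain J u where max: "maximal_solution F X a J u" unfolding flow_dom_def by blast
  then have u: "solution F X a J u" by (simp add: maximal_solution_def)
  then have J0: "0 \<in> J" and J_ge: "J \<subseteq> {0..}" by (simp_all add: solution_def)
  have uX: "u t \<in> X" if "t \<in> J" for t using u that by (simp add: solution_def)
  have orb: "orbit F X (u t) = u ` {r \<in> J. t \<le> r}" if t: "t \<in> J" for t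
  proof -
    have "orbit F X (u t) = (\<lambda>s. u (t + s)) ` {s. 0 \<le> s \<and> t + s \<in> J}"
      by (rule orbit_eq[OF maximal_solution_shift[OF max t] uX[OF t]])
    also have "\<dots> = u ` ((\<lambda>s. t + s) ` {s. 0 \<le> s \<and> t + s \<in> J})" by (simp add: image_image)
    also have "(\<lambda>s. t + s) ` {s. 0 \<le> s \<and> t + s \<in> J} = {r \<in> J. t \<le> r}"
    proof (intro equalityI subsetI)
      fix r assume "r \<in> {r \<in> J. t \<le> r}"
      then show "r \<in> (\<lambda>s. t + s) ` {s. 0 \<le> s \<and> t + s \<in> J}" by (intro image_eqI[of _ _ "r - t"]) auto
    qed auto
    finally show ?thesis .
  qed
  have times: "{t. 0 \<le> t \<and> a \<in> flow_dom F X t} = J"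
    using flow_dom_iff[OF max a] J_ge by auto
  have omega: "omega_limit F X a = (\<Inter>t\<in>J. closure (u ` {r \<in> J. t \<le> r}))"
    unfolding omega_limit_def times using flow_eq[OF max] orb by simp
  have "closure (u ` J) \<inter> (\<Inter>t\<in>J. closure (u ` {r \<in> J. t \<le> r})) \<noteq> {}"
  proof (rule compact_imp_fip_image)
    show "compact (closure (u ` J))" using att orbit_eq[OF max a] by (simp add: attracts_def)
    show "closed (closure (u ` {r \<in> J. t \<le> r}))" for t by simp
    fix I assume I: "finite I" "I \<subseteq> J"
    \<comment> \<open>The orbit point at the latest of finitely many times is in all the corresponding closures; \<open>0\<close> is
      inserted for the case that there are none.\<close>
    define m where "m = Max (insert 0 I)"
    have "m \<in> insert 0 I" using I(1) unfolding m_def by (intro Max_in) auto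
    then have m: "m \<in> J" using I(2) J0 by blast
    have "t \<le> m" if "t \<in> I" for t using I(1) that by (simp add: m_def)
    then have "u m \<in> (\<Inter>t\<in>I. closure (u ` {r \<in> J. t \<le> r}))"
      using m by (intro INT_I closure_subset[THEN subsetD] imageI) simp
    moreover have "u m \<in> closure (u ` J)" using m by (intro closure_subset[THEN subsetD] imageI)
    ultimately show "closure (u ` J) \<inter> (\<Inter>t\<in>I. closure (u ` {r \<in> J. t \<le> r})) \<noteq> {}" by blast
  qed
  then obtain p where p: "p \<in> closure (u ` J)" "p \<in> omega_limit F X a" unfolding omega by blast
  then have "p \<in> W" using att W(2) unfolding attracts_def by blast
  then have "W \<inter> u ` J \<noteq> {}" using p(1) W(1) open_Int_closure_eq_empty[of W "u ` J"] by blast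
  then obtain t where t: "t \<in> J" "u t \<in> N" using W(3) by blast
  obtain w where w: "solution F X (u t) {0..} w"
    using global_solution_in_positively_invariant[OF N t(2)] .
  have "{0..t} \<union> (\<lambda>s. t + s) ` {0..} = {0..}"
  proof -
    have "0 \<le> t" using t J_ge by auto
    moreover have "r \<in> (\<lambda>s. t + s) ` {0..}" if "t \<le> r" for r
      using that by (intro image_eqI[of _ _ "r - t"]) auto
    ultimately show ?thesis by fastforce
  qed
  then show thesis using solution_append[OF u t(1) w] that by simp
qed

section \<open>Systems with a global attractor\<close>

text \<open>A neighborhood \<open>W\<close> of \<open>A\<close> inside a positively invariant set turns attraction into global existence
  at every point of \<open>X\<close>; after that, attraction and stability are translated into sequences and
  open sets.\<close>

lemma semiflow_with_attractor_of_system: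
  fixes F :: "real^'n \<Rightarrow> real^'n" and X A :: "(real^'n) set"
  assumes sys: "dyn_system F X" and X: "open X" and glob: "global_attractor F X A"
  shows "C1_semiflow_with_attractor F X (partial_deriv F X) (flow F X) A"
    and "\<And>x t. x \<in> X \<Longrightarrow> 0 \<le> t \<Longrightarrow> x \<in> flow_dom F X t"
proof -
  interpret C1_field F X "partial_deriv F X" by (rule C1_field_of_system[OF sys X])
  have att: "\<And>x. x \<in> X \<Longrightarrow> attracts F X A x" and compact: "compact A"
    and inv: "positively_invariant F X A" "\<And>t. 0 \<le> t \<Longrightarrow> flow F X t ` A = A"
    and small: "\<And>U. neighborhood_in X A U \<Longrightarrow>
      \<exists>N. neighborhood_in X A N \<and> N \<subseteq> U \<and> positively_invariant F X N"
    using glob unfolding global_attractor_def attractor_def attracting_def invariant_set_def by blast+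
  have AX: "A \<subseteq> X" using inv(1) by (simp add: positively_invariant_def)
  have stable: "\<exists>N W. open W \<and> A \<subseteq> W \<and> W \<subseteq> N \<and> N \<subseteq> V \<and> N \<subseteq> X \<and> positively_invariant F X N"
    if V: "open V" "A \<subseteq> V" for V
  proof -
    have "openin (top_of_set X) (X \<inter> V)" using V(1) by (rule openin_open_Int)
    then have "neighborhood_in X A (X \<inter> V)"
      using AX V(2) unfolding neighborhood_in_def by blast
    then obtain N where N: "neighborhood_in X A N" "N \<subseteq> X \<inter> V" "positively_invariant F X N"
      using small by blast
    then obtain W where "openin (top_of_set X) W" "A \<subseteq> W" "W \<subseteq> N"
      unfolding neighborhood_in_def by blast
    moreover from this have "open W" using X openin_open_eq by blast
    ultimately show ?thesis using N by blast
  qed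
  obtain N W where NW: "open W" "A \<subseteq> W" "W \<subseteq> N" "positively_invariant F X N"
    using stable[OF open_UNIV subset_UNIV] by blast
  have "\<exists>w. solution F X x {0..} w" if x: "x \<in> X" for x
    by (rule global_solution_if_attracted[OF att[OF x] x compact NW]) blast
  then obtain w where w: "\<And>x. x \<in> X \<Longrightarrow> solution F X x {0..} (w x)" by metis
  have max: "maximal_solution F X x {0..} (w x)" if "x \<in> X" for x
    by (rule global_solution_maximal[OF w[OF that]])
  show dom: "x \<in> flow_dom F X t" if "x \<in> X" "0 \<le> t" for x t
    using flow_dom_iff[OF max[OF that(1)] that(1)] that(2) by simp
  have eq: "flow F X t x = w x t" if "x \<in> X" "0 \<le> t" for x t
    using flow_eq[OF max[OF that(1)]] that(2) by simp
  interpret C1_semiflow F X "partial_deriv F X" "flow F X"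
  proof
    fix x :: "real^'n" and t :: real
    assume x: "x \<in> X"
    have wx: "w x 0 = x" "\<And>t. 0 \<le> t \<Longrightarrow> w x t \<in> X"
      "\<And>t. 0 \<le> t \<Longrightarrow> (w x has_vector_derivative F (w x t)) (at t within {0..})"
      using w[OF x] by (simp_all add: solution_def)
    show "flow F X 0 x = x" using eq[OF x] wx by simp
    assume t: "0 \<le> t"
    show "flow F X t x \<in> X" using eq[OF x t] wx t by simp
    show "((\<lambda>t. flow F X t x) has_vector_derivative F (flow F X t x)) (at t within {0..})"
      unfolding eq[OF x t]
      by (rule has_vector_derivative_transform[OF _ _ wx(3)[OF t]]) (use t eq[OF x] in auto)
  qed
  show "C1_semiflow_with_attractor F X (partial_deriv F X) (flow F X) A"
  proof
    show "compact A" "A \<subseteq> X" by (rule compact AX)+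
    show "flow F X t ` A = A" if "0 \<le> t" for t by (rule inv(2)[OF that])
    show "\<exists>N W. open W \<and> A \<subseteq> W \<and> W \<subseteq> N \<and> N \<subseteq> V \<and> N \<subseteq> X \<and> (\<forall>x\<in>N. \<forall>t\<ge>0. flow F X t x \<in> N)"
      if "open V" "A \<subseteq> V" for V
      using stable[OF that] unfolding positively_invariant_def by meson
    fix x :: "real^'n" and \<tau> :: "nat \<Rightarrow> real"
    assume x: "x \<in> X" and \<tau>: "\<And>k. 0 \<le> \<tau> k" "filterlim \<tau> at_top sequentially"
    have in_orbit: "flow F X s y \<in> orbit F X y" if "y \<in> X" "0 \<le> s" for y s
      using dom that unfolding orbit_def by blast
    have "flow F X (\<tau> k) x \<in> closure (orbit F X x)" for k
      by (rule closure_subset[THEN subsetD, OF in_orbit[OF x \<tau>(1)]])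
    moreover have "seq_compact (closure (orbit F X x))"
      using att[OF x] by (simp add: attracts_def compact_eq_seq_compact_metric)
    ultimately obtain z r where z: "strict_mono (r :: nat \<Rightarrow> nat)" "((\<lambda>k. flow F X (\<tau> k) x) \<circ> r) \<longlonglongrightarrow> z"
      unfolding seq_compact_def by meson
    have "z \<in> closure (orbit F X (flow F X t x))" if t: "0 \<le> t" for t
    proof (rule Lim_in_closed_set[OF closed_closure _ trivial_limit_sequentially z(2)])
      have "\<forall>\<^sub>F k in sequentially. t \<le> \<tau> (r k)"
        using filterlim_compose[OF \<tau>(2) filterlim_subseq[OF z(1)]] by (simp add: filterlim_at_top)
      then show "\<forall>\<^sub>F k in sequentially. ((\<lambda>k. flow F X (\<tau> k) x) \<circ> r) k \<in> closure (orbit F X (flow F X t x))"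
      proof (rule eventually_mono)
        fix k assume k: "t \<le> \<tau> (r k)"
        have "flow F X (\<tau> (r k)) x = flow F X (\<tau> (r k) - t) (flow F X t x)"
          using flow_add[OF x t, of "\<tau> (r k) - t"] k by simp
        also have "\<dots> \<in> orbit F X (flow F X t x)" using k by (intro in_orbit flow_in x t) simp
        finally show "((\<lambda>k. flow F X (\<tau> k) x) \<circ> r) k \<in> closure (orbit F X (flow F X t x))"
          using closure_subset by (auto simp: o_def)
      qed
    qed
    then have "z \<in> omega_limit F X x" unfolding omega_limit_def by blast
    then have "z \<in> A" using att[OF x] unfolding attracts_def by blast
    then show "\<exists>z\<in>A. \<exists>r. strict_mono r \<and> (\<lambda>k. flow F X (\<tau> (r k)) x) \<longlonglongrightarrow> z"
      using z by (auto simp: o_def)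
  qed
qed

theorem theorem3:
  fixes F :: "real^'n \<Rightarrow> real^'n" and X A :: "(real^'n) set"
  assumes "dyn_system F X"
    and "coherent F X"
    and "open X"
    and "global_attractor F X A"
  shows "(\<exists>p. equilibrium F X p) \<and>
    (\<forall>q. equilibrium F X q \<and> (\<forall>p. equilibrium F X p \<longrightarrow> p = q) \<longrightarrow>
      globally_asymptotically_stable F X q)"
proof -
  note system = semiflow_with_attractor_of_system[OF assms(1,3,4)]
  interpret C1_semiflow_with_attractor F X "partial_deriv F X" "flow F X" A by (rule system(1))
  have eq_iff: "equilibrium F X p \<longleftrightarrow> p \<in> X \<and> (\<forall>t\<ge>0. flow F X t p = p)" for p
    using system(2) unfolding equilibrium_def by blast
  have "A \<noteq> {}"
    using assms(4) by (simp add: global_attractor_def attractor_def attracting_def invariant_set_def)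
  then obtain a where "a \<in> X" using A_subset by blast
  then have "\<exists>p\<in>X \<inter> UNIV. \<forall>t\<ge>0. flow F X t p = p"
    by (intro exists_equilibrium_in_invariant_convex[of UNIV a]) auto
  then have "\<exists>p. equilibrium F X p" unfolding eq_iff by blast
  moreover have "globally_asymptotically_stable F X q"
    if q: "equilibrium F X q" and unique: "\<forall>p. equilibrium F X p \<longrightarrow> p = q" for q
  proof -
    have "A = {q}"
    proof (rule attractor_collapses)
      show "\<exists>\<sigma> C. C \<noteq> {} \<and> cooperative_block \<sigma> S C" if "upstream_closed S" "S \<noteq> UNIV" for S
        by (rule exists_cooperative_block[OF C1_field_axioms assms(2) that])
      show "q \<in> X" "\<And>t. 0 \<le> t \<Longrightarrow> flow F X t q = q" using q unfolding eq_iff by blast+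
      show "\<forall>p\<in>X. (\<forall>t\<ge>0. flow F X t p = p) \<longrightarrow> p = q" using unique unfolding eq_iff by blast
    qed
    then show ?thesis using q assms(4) by (simp add: globally_asymptotically_stable_def)
  qed
  ultimately show ?thesis by blast
qed

end
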